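(* Let $M$ be a matrix dilation of the form $\begin{pmatrix}\gamma_1&0\\0&\gamma_2\end{pmatrix}$ or $\begin{pmatrix}0&\gamma_1\\\gamma_2&0\end{pmatrix}$ with $\gamma_1,\gamma_2\in\mathbb Z$, let $m=|\det M|=|\gamma_1\gamma_2|$ and $n\in\mathbb N$. Let masks $m_0$ and $\widetilde m_0$ be axial symmetric with respect to the origin, let $m_0$ have sum rule of order $n$ (with respect to $M$), and let $\widetilde m_0$ satisfy $$D^\beta\big(1-m_0(\xi)\overline{\widetilde m_0(\xi)}\big)\Big|_{\xi=\mathbf 0}=0\qquad\forall\beta\in\Delta_n.$$ Then there exist wavelet masks $m_\nu$ and $\widetilde m_\nu$, $\nu=1,\dots,m$ (for $m_0,\widetilde m_0$), each of which is axial symmetric or axial antisymmetric with respect to some center, and such that the masks $\widetilde m_\nu$, $\nu=1,\dots,m$, have vanishing moments of order $n$.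
   Context: A matrix dilation $M$ is an integer matrix all of whose eigenvalues are bigger than 1 in modulus; $M^*$ is its conjugate (transpose). A set of digits $D(M)=\{s_0,\dots,s_{m-1}\}$ contains exactly one representative of each coset of $\mathbb Z^2/M\mathbb Z^2$. $\Delta_n=\{\alpha\in\mathbb Z^2_+:\alpha_1+\alpha_2<n\}$. A trigonometric polynomial is a finite sum $t(\xi)=\sum_{k\in\mathbb Z^2}h_ke^{2\pi i(k,\xi)}$, $h_k\in\mathbb C$; a mask (refinable mask) is a trigonometric polynomial equal to 1 at $\mathbf 0$. The polyphase components $\tau_k$, $k=0,\dots,m-1$, of $t$ are the unique trigonometric polynomials with $t(\xi)=\frac1{\sqrt m}\sum_{k=0}^{m-1}e^{2\pi i(s_k,\xi)}\tau_k(M^*\xi)$. The axial symmetry group is $G^{axis}=\{\pm I_2,\pm Y\}$, $Y=\begin{pmatrix}-1&0\\0&1\end{pmatrix}$. $t$ is axial symmetric with respect to a center $c\in\frac12\mathbb Z^2$ if $t(\xi)=e^{2\pi i(c-Ec,\xi)}t(E^*\xi)$ for all $E\in G^{axis}$; $t$ is axial antisymmetric with respect to the center $c$ if for every $E\in G^{axis}$, $t(\xi)=\pm e^{2\pi i(c-Ec,\xi)}t(E^*\xi)$ with a sign that may depend on $E$. $t$ has sum rule of order $n$ with respect to $M$ if $D^\beta(t(M^{*-1}\xi))|_{\xi=s}=0$ for all $s\in D(M^* )\setminus\{\mathbf 0\}$, $\beta\in\Delta_n$ (where $\mathbf 0\in D(M^* )$). $t$ has vanishing moments of order $n$ if $D^\beta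 t(\mathbf 0)=0$ for all $\beta\in\Delta_n$. Wavelet masks: given masks $m_0,\widetilde m_0$, trigonometric polynomials $m_\nu,\widetilde m_\nu$, $\nu=1,\dots,m$, are called wavelet masks for $m_0,\widetilde m_0$ if the $(m+1)\times m$ matrices $\mathcal M=(\mu_{\nu k})$, $\widetilde{\mathcal M}=(\widetilde\mu_{\nu k})$, $\nu=0,\dots,m$, $k=0,\dots,m-1$, where $\mu_{\nu k}$, $\widetilde\mu_{\nu k}$ are the polyphase components of $m_\nu$, $\widetilde m_\nu$, satisfy $\mathcal M^T\overline{\widetilde{\mathcal M}}=I_m$ (mixed extension principle). *)

theory Defs
  imports "HOL-Analysis.Analysis"
begin

abbreviation rvec :: "int ^ 'n \<Rightarrow> real ^ 'n" where
  "rvec k \<equiv> (\<chi> i. real_of_int (k $ i))"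

abbreviation rmat :: "int ^ 'n ^ 'm \<Rightarrow> real ^ 'n ^ 'm" where
  "rmat A \<equiv> map_matrix real_of_int A"

definition matrix_dilation :: "int ^ 2 ^ 2 \<Rightarrow> bool" where
  "matrix_dilation M \<longleftrightarrow>
     (\<forall>(z :: complex) v. v \<noteq> 0 \<and> map_matrix of_int M *v v = z *s v \<longrightarrow> cmod z > 1)"

abbreviation absdet :: "int ^ 2 ^ 2 \<Rightarrow> nat" where
  "absdet M \<equiv> nat \<bar>det M\<bar>"

definition digit_set :: "int ^ 2 ^ 2 \<Rightarrow> (int ^ 2) set \<Rightarrow> bool" where
  "digit_set M D \<longleftrightarrow> (\<forall>k. \<exists>!d. d \<in> D \<and> (\<exists>l. k - d = M *v l))"

definition digits :: "int ^ 2 ^ 2 \<Rightarrow> (nat \<Rightarrow> int ^ 2) \<Rightarrow> bool" where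
  "digits M s \<longleftrightarrow> inj_on s {..<absdet M} \<and> digit_set M (s ` {..<absdet M})"

definition Delta :: "nat \<Rightarrow> (nat \<times> nat) set" where
  "Delta n = {(a, b). a + b < n}"

definition echar :: "real ^ 2 \<Rightarrow> real ^ 2 \<Rightarrow> complex" where
  "echar x \<xi> = cis (2 * pi * (x \<bullet> \<xi>))"

definition trig_poly :: "(real ^ 2 \<Rightarrow> complex) \<Rightarrow> bool" where
  "trig_poly t \<longleftrightarrow>
     (\<exists>K h. finite K \<and> (\<forall>\<xi>. t \<xi> = (\<Sum>k\<in>K. h k * echar (rvec k) \<xi>)))"

definition is_mask :: "(real ^ 2 \<Rightarrow> complex) \<Rightarrow> bool" where
  "is_mask t \<longleftrightarrow> trig_poly t \<and> t 0 = 1"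

definition partial_deriv :: "2 \<Rightarrow> (real ^ 2 \<Rightarrow> complex) \<Rightarrow> real ^ 2 \<Rightarrow> complex" where
  "partial_deriv i f x = vector_derivative (\<lambda>u. f (x + u *\<^sub>R axis i 1)) (at 0)"

definition mixed_partial :: "nat \<times> nat \<Rightarrow> (real ^ 2 \<Rightarrow> complex) \<Rightarrow> real ^ 2 \<Rightarrow> complex" where
  "mixed_partial \<beta> f = (partial_deriv 1 ^^ fst \<beta>) ((partial_deriv 2 ^^ snd \<beta>) f)"

text \<open>The zero digit is excluded from \<open>D\<close>, a digit set of the transpose of \<open>M\<close> that is
  meant to contain it. The condition does not depend on the choice of \<open>D\<close>.\<close>

definition sum_rule ::
    "int ^ 2 ^ 2 \<Rightarrow> (int ^ 2) set \<Rightarrow> nat \<Rightarrow> (real ^ 2 \<Rightarrow> complex) \<Rightarrow> bool" where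
  "sum_rule M D n t \<longleftrightarrow>
     (\<forall>s \<in> D - {0}. \<forall>\<beta> \<in> Delta n.
        mixed_partial \<beta> (\<lambda>\<xi>. t (matrix_inv (transpose (rmat M)) *v \<xi>)) (rvec s) = 0)"

definition vanishing_moments :: "nat \<Rightarrow> (real ^ 2 \<Rightarrow> complex) \<Rightarrow> bool" where
  "vanishing_moments n t \<longleftrightarrow> (\<forall>\<beta> \<in> Delta n. mixed_partial \<beta> t 0 = 0)"

definition reflY :: "real ^ 2 ^ 2" where
  "reflY = vector [vector [-1, 0], vector [0, 1]]"

definition axis_group :: "(real ^ 2 ^ 2) set" where
  "axis_group = {mat 1, - mat 1, reflY, - reflY}"

definition half_integral :: "real ^ 2 \<Rightarrow> bool" where
  "half_integral c \<longleftrightarrow> (\<exists>k. c = (1/2) *\<^sub>R rvec k)"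

definition axial_symmetric :: "real ^ 2 \<Rightarrow> (real ^ 2 \<Rightarrow> complex) \<Rightarrow> bool" where
  "axial_symmetric c t \<longleftrightarrow> half_integral c \<and>
     (\<forall>E \<in> axis_group. \<forall>\<xi>. t \<xi> = echar (c - E *v c) \<xi> * t (transpose E *v \<xi>))"

definition axial_antisymmetric :: "real ^ 2 \<Rightarrow> (real ^ 2 \<Rightarrow> complex) \<Rightarrow> bool" where
  "axial_antisymmetric c t \<longleftrightarrow> half_integral c \<and>
     (\<forall>E \<in> axis_group. \<exists>\<epsilon> \<in> {1, -1}.
        \<forall>\<xi>. t \<xi> = \<epsilon> * echar (c - E *v c) \<xi> * t (transpose E *v \<xi>))"

text \<open>For digits \<open>s\<close> of a nonsingular \<open>M\<close>, every trigonometric polynomial has exactly one family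
  of polyphase components indexed by \<open>{..<absdet M}\<close>; the values of \<open>\<tau>\<close> at other indices are
  irrelevant. The existential in \<open>wavelet_masks\<close> thus refers to that unique family.\<close>

definition polyphase_components ::
    "int ^ 2 ^ 2 \<Rightarrow> (nat \<Rightarrow> int ^ 2) \<Rightarrow> (real ^ 2 \<Rightarrow> complex) \<Rightarrow>
     (nat \<Rightarrow> real ^ 2 \<Rightarrow> complex) \<Rightarrow> bool" where
  "polyphase_components M s t \<tau> \<longleftrightarrow>
     (\<forall>k < absdet M. trig_poly (\<tau> k)) \<and>
     (\<forall>\<xi>. t \<xi> = 1 / complex_of_real (sqrt (real (absdet M))) *
        (\<Sum>k < absdet M. echar (rvec (s k)) \<xi> * \<tau> k (transpose (rmat M) *v \<xi>)))"

text \<open>The wavelet masks are \<open>w \<nu>\<close> and \<open>w' \<nu>\<close> for \<open>\<nu> = 1, \<dots>, absdet M\<close>; row \<open>0\<close> of the polyphase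
  matrices comes from the given pair \<open>m0\<close>, \<open>m0'\<close>. For polyphase matrices \<open>P\<close>, \<open>P'\<close> of size
  \<open>(absdet M + 1) \<times> absdet M\<close>, the last conjunct is the \<open>(k, l)\<close> entry of the equation
  that the transpose of \<open>P\<close> times the complex conjugate of \<open>P'\<close> is the identity.\<close>

definition wavelet_masks ::
    "int ^ 2 ^ 2 \<Rightarrow> (nat \<Rightarrow> int ^ 2) \<Rightarrow> (real ^ 2 \<Rightarrow> complex) \<Rightarrow> (real ^ 2 \<Rightarrow> complex) \<Rightarrow>
     (nat \<Rightarrow> real ^ 2 \<Rightarrow> complex) \<Rightarrow> (nat \<Rightarrow> real ^ 2 \<Rightarrow> complex) \<Rightarrow> bool" where
  "wavelet_masks M s m0 m0' w w' \<longleftrightarrow>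
     (\<forall>\<nu> \<in> {1..absdet M}. trig_poly (w \<nu>) \<and> trig_poly (w' \<nu>)) \<and>
     (\<exists>\<mu> \<mu>'.
        (\<forall>\<nu> \<in> {0..absdet M}.
           polyphase_components M s ((w(0 := m0)) \<nu>) (\<mu> \<nu>) \<and>
           polyphase_components M s ((w'(0 := m0')) \<nu>) (\<mu>' \<nu>)) \<and>
        (\<forall>\<xi>. \<forall>k < absdet M. \<forall>l < absdet M.
           (\<Sum>\<nu> = 0..absdet M. \<mu> \<nu> k \<xi> * cnj (\<mu>' \<nu> l \<xi>)) = (if k = l then 1 else 0)))"

end

theory Submission
  imports Defs
begin

text \<open>
  Write \<open>m = |det M|\<close>, let \<open>e\<^sub>v\<close> be the exponential with frequency \<open>v\<close>, and let \<open>P\<^sub>v\<close> be the part of \<open>m\<^sub>0\<close>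
  with frequencies in the coset of \<open>v\<close> modulo the lattice of \<open>M\<close>; up to normalisation these parts are
  the polyphase components. For either form of \<open>M\<close> this lattice is
  \<open>\<gamma>\<^sub>1 \<int> \<times> \<gamma>\<^sub>2 \<int>\<close>, so everything splits into one-dimensional constructions.

  Disregarding symmetry, the functions \<open>e\<^sub>v / \<surd>m\<close> and \<open>e\<^sub>v (1 - m cnj P\<^sub>v m\<^sub>0') / \<surd>m\<close>, one pair for each
  coset \<open>v\<close>, are wavelet masks: their polyphase matrices are the identity and the identity minus
  the rank-one matrix that the given pair of masks contributes. The second family has vanishing
  moments: by the sum rule, \<open>m P\<^sub>v\<close> agrees with \<open>m\<^sub>0\<close> at the origin up to order \<open>n\<close>
  (\<open>coset_part_approx\<close>, \<open>sum_rule_dual_points\<close>), so \<open>1 - m cnj P\<^sub>v m\<^sub>0'\<close> agrees with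
  \<open>1 - cnj m\<^sub>0 m\<^sub>0'\<close>, which vanishes there to order \<open>n\<close> by assumption.

  To gain symmetry, apply one real orthogonal matrix to both families. This changes neither the
  duality relation nor the vanishing moments. As \<open>m\<^sub>0\<close> and \<open>m\<^sub>0'\<close> are symmetric, the reflections
  permute the functions \<open>1 - m cnj P\<^sub>v m\<^sub>0'\<close> in the way they permute the cosets (\<open>coset_part_flip\<close>).
  In each coordinate, pair the residue \<open>r\<close> with its negative, and replace the two monomials by their
  normalised sum and difference. The product of these two one-dimensional matrices turns the families into
  axially symmetric or antisymmetric ones (\<open>fold_combination_symmetric\<close>). The centres have
  coordinates \<open>0\<close> or \<open>|\<gamma>\<^sub>i| / 2\<close>, because the digits are taken in
  \<open>{0..<|\<gamma>\<^sub>1|} \<times> {0..<|\<gamma>\<^sub>2|}\<close>.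
\<close>

section \<open>Exponential sums with prescribed frequencies\<close>

text \<open>
  Recording a set that contains all frequencies lets one notion serve three purposes: integral
  frequencies give trigonometric polynomials, frequencies in a coset of the lattice of \<open>M\<close> give a
  single polyphase component, and arbitrary real frequencies are closed under the real linear
  substitution \<open>\<xi> \<mapsto> M\<^sup>*\<^sup>-\<^sup>1 \<xi>\<close> in the sum rule.
\<close>
inductive exp_sum :: "(real ^ 2) set \<Rightarrow> (real ^ 2 \<Rightarrow> complex) \<Rightarrow> bool" for L where
  zero: "exp_sum L (\<lambda>_. 0)"
| step: "exp_sum L f \<Longrightarrow> k \<in> L \<Longrightarrow> exp_sum L (\<lambda>\<xi>. f \<xi> + c * echar k \<xi>)"

lemma echar_0 [simp]: "echar 0 \<xi> = 1" "echar x 0 = 1"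
  by (simp_all add: echar_def)

lemma echar_add: "echar (x + y) \<xi> = echar x \<xi> * echar y \<xi>"
  by (simp add: echar_def cis_mult inner_add_left ring_distribs)

lemma echar_add_right: "echar x (\<xi> + \<eta>) = echar x \<xi> * echar x \<eta>"
  by (simp add: echar_def cis_mult inner_add_right ring_distribs)

lemma echar_minus: "echar (- x) \<xi> = cnj (echar x \<xi>)"
  by (simp add: echar_def cis_cnj)

lemma echar_diff: "echar (x - y) \<xi> = echar x \<xi> * cnj (echar y \<xi>)"
  using echar_add[of x "- y"] by (simp add: echar_minus)

lemma echar_cnj [simp]:
  "echar x \<xi> * cnj (echar x \<xi>) = 1" "cnj (echar x \<xi>) * echar x \<xi> = 1"
  by (simp_all add: echar_def cis_cnj cis_mult)

lemma echar_matrix: "echar x (A *v \<xi>) = echar (transpose A *v x) \<xi>"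
  by (simp add: echar_def dot_lmul_matrix[symmetric] transpose_matrix_vector)

lemma exp_sum_echar: "k \<in> L \<Longrightarrow> exp_sum L (echar k)"
  using exp_sum.step[OF exp_sum.zero, of k L 1] by simp

lemma exp_sum_const: "0 \<in> L \<Longrightarrow> exp_sum L (\<lambda>_. c)"
  using exp_sum.step[OF exp_sum.zero, of 0 L c] by simp

lemma exp_sum_add:
  assumes "exp_sum L f" "exp_sum L g"
  shows "exp_sum L (\<lambda>\<xi>. f \<xi> + g \<xi>)"
  using assms(2)
proof (induction rule: exp_sum.induct)
  case zero
  then show ?case using assms(1) by simp
next
  case (step g k c)
  then show ?case using exp_sum.step[of L "\<lambda>\<xi>. f \<xi> + g \<xi>" k c] by (simp add: add.assoc)
qed

lemma exp_sum_sum: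
  "(\<And>i. i \<in> I \<Longrightarrow> exp_sum L (f i)) \<Longrightarrow> exp_sum L (\<lambda>\<xi>. \<Sum>i\<in>I. f i \<xi>)"
  by (induction I rule: infinite_finite_induct) (auto intro: exp_sum.zero exp_sum_add)

lemma exp_sum_mult_echar:
  "exp_sum L f \<Longrightarrow> (\<And>l. l \<in> L \<Longrightarrow> l + k \<in> L') \<Longrightarrow> exp_sum L' (\<lambda>\<xi>. f \<xi> * (c * echar k \<xi>))"
proof (induction rule: exp_sum.induct)
  case (step f l d)
  have "(\<lambda>\<xi>. (f \<xi> + d * echar l \<xi>) * (c * echar k \<xi>)) =
      (\<lambda>\<xi>. f \<xi> * (c * echar k \<xi>) + d * c * echar (l + k) \<xi>)"
    by (simp add: echar_add algebra_simps)
  moreover have "exp_sum L' (\<lambda>\<xi>. f \<xi> * (c * echar k \<xi>) + d * c * echar (l + k) \<xi>)"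
    using step by (intro exp_sum.step) auto
  ultimately show ?case by simp
qed (simp add: exp_sum.zero)

lemma exp_sum_mult:
  assumes "exp_sum L f" "exp_sum L' g" "\<And>k l. k \<in> L \<Longrightarrow> l \<in> L' \<Longrightarrow> k + l \<in> L''"
  shows "exp_sum L'' (\<lambda>\<xi>. f \<xi> * g \<xi>)"
  using assms(2)
proof (induction rule: exp_sum.induct)
  case (step g k c)
  then show ?case
    using exp_sum_add[OF step.IH exp_sum_mult_echar[OF assms(1), of k L'' c]] assms(3)
    by (simp add: algebra_simps)
qed (simp add: exp_sum.zero)

lemma exp_sum_cmult: "exp_sum L f \<Longrightarrow> exp_sum L (\<lambda>\<xi>. c * f \<xi>)"
  using exp_sum_mult_echar[of L f 0 L c] by (simp add: mult.commute)

lemma exp_sum_diff: "exp_sum L f \<Longrightarrow> exp_sum L g \<Longrightarrow> exp_sum L (\<lambda>\<xi>. f \<xi> - g \<xi>)"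
  using exp_sum_add[OF _ exp_sum_cmult[of L g "-1"], of f] by simp

lemma exp_sum_cnj:
  "exp_sum L f \<Longrightarrow> (\<And>k. k \<in> L \<Longrightarrow> - k \<in> L') \<Longrightarrow> exp_sum L' (\<lambda>\<xi>. cnj (f \<xi>))"
proof (induction rule: exp_sum.induct)
  case (step f k c)
  then show ?case
    using exp_sum.step[of L' "\<lambda>\<xi>. cnj (f \<xi>)" "- k" "cnj c"] by (simp add: echar_minus)
qed (simp add: exp_sum.zero)

lemma exp_sum_affine:
  "exp_sum L f \<Longrightarrow> (\<And>k. k \<in> L \<Longrightarrow> transpose A *v k \<in> L') \<Longrightarrow> exp_sum L' (\<lambda>\<xi>. f (A *v \<xi> + b))"
proof (induction rule: exp_sum.induct)
  case (step f k c)
  then show ?case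
    using exp_sum.step[of L' "\<lambda>\<xi>. f (A *v \<xi> + b)" "transpose A *v k" "c * echar k b"]
    by (simp add: echar_add_right echar_matrix mult_ac)
qed (simp add: exp_sum.zero)

lemma exp_sum_mono: "exp_sum L f \<Longrightarrow> L \<subseteq> L' \<Longrightarrow> exp_sum L' f"
  by (induction rule: exp_sum.induct) (auto intro: exp_sum.intros)

abbreviation integral_vectors :: "(real ^ 2) set" where
  "integral_vectors \<equiv> range rvec"

lemma rvec_add: "rvec (k + l) = rvec k + rvec l"
  and rvec_minus: "rvec (- k) = - rvec k"
  and rvec_diff: "rvec (k - l) = rvec k - rvec l"
  by (simp_all add: vec_eq_iff)

lemma trig_poly_iff_exp_sum: "trig_poly f \<longleftrightarrow> exp_sum integral_vectors f"
proof
  assume "trig_poly f"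
  then obtain K h where "finite K" and f: "f = (\<lambda>\<xi>. \<Sum>k\<in>K. h k * echar (rvec k) \<xi>)"
    unfolding trig_poly_def by blast
  show "exp_sum integral_vectors f"
    unfolding f by (intro exp_sum_sum exp_sum_cmult exp_sum_echar) simp
next
  assume "exp_sum integral_vectors f"
  then show "trig_poly f"
  proof (induction rule: exp_sum.induct)
    case zero
    show ?case unfolding trig_poly_def by (intro exI[of _ "{}"]) simp
  next
    case (step f k c)
    then obtain K h l where K: "finite K" "\<And>\<xi>. f \<xi> = (\<Sum>k\<in>K. h k * echar (rvec k) \<xi>)"
      and k: "k = rvec l"
      unfolding trig_poly_def by blast
    \<comment> \<open>The new frequency may already occur, so its coefficient is added to the old one.\<close>
    define h' where "h' j = (if j \<in> K then h j else 0) + (if j = l then c else 0)" for j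
    have "f \<xi> + c * echar k \<xi> = (\<Sum>j\<in>insert l K. h' j * echar (rvec j) \<xi>)" for \<xi>
    proof -
      have "(\<Sum>j\<in>insert l K. h' j * echar (rvec j) \<xi>) =
          (\<Sum>j\<in>insert l K. (if j \<in> K then h j * echar (rvec j) \<xi> else 0)) +
          (\<Sum>j\<in>insert l K. (if j = l then c * echar (rvec j) \<xi> else 0))"
        unfolding sum.distrib[symmetric] by (intro sum.cong) (auto simp: h'_def ring_distribs)
      also have "(\<Sum>j\<in>insert l K. (if j \<in> K then h j * echar (rvec j) \<xi> else 0)) =
          (\<Sum>j\<in>K. h j * echar (rvec j) \<xi>)"
        using K(1) by (intro sum.mono_neutral_cong_right) auto
      finally show ?thesis using K by (simp add: k)
    qed
    then show ?case unfolding trig_poly_def using K(1) by (intro exI[of _ "insert l K"] exI[of _ h']) simp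
  qed
qed

lemma echar_integral: "echar (rvec k) (rvec l) = 1"
  unfolding echar_def
  by (rule cis_multiple_2pi) (auto simp: inner_vec_def intro!: Ints_sum Ints_mult)

lemma exp_sum_int_periodic:
  "exp_sum integral_vectors f \<Longrightarrow> f (\<xi> + rvec l) = f \<xi>"
proof (induction rule: exp_sum.induct)
  case (step f k c)
  then obtain j where k: "k = rvec j" by blast
  show ?case unfolding k echar_add_right echar_integral using step.IH by simp
qed simp

section \<open>Vanishing derivatives\<close>

abbreviation vanishes_to_order :: "nat \<Rightarrow> (real ^ 2 \<Rightarrow> complex) \<Rightarrow> real ^ 2 \<Rightarrow> bool" where
  "vanishes_to_order n f x \<equiv> \<forall>\<beta> \<in> Delta n. mixed_partial \<beta> f x = 0"

definition has_partial :: "2 \<Rightarrow> (real ^ 2 \<Rightarrow> complex) \<Rightarrow> (real ^ 2 \<Rightarrow> complex) \<Rightarrow> bool" where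
  "has_partial i f g \<longleftrightarrow>
     (\<forall>x. ((\<lambda>u. f (x + u *\<^sub>R axis i 1)) has_vector_derivative g x) (at 0))"

lemma has_partial_eq: "has_partial i f g \<Longrightarrow> partial_deriv i f = g"
  unfolding has_partial_def partial_deriv_def by (auto intro!: vector_derivative_at)

lemma has_partial_add:
  "has_partial i f f' \<Longrightarrow> has_partial i g g' \<Longrightarrow> has_partial i (\<lambda>x. f x + g x) (\<lambda>x. f' x + g' x)"
  unfolding has_partial_def by (intro allI has_vector_derivative_add) blast+

lemma has_partial_mult:
  assumes "has_partial i f f'" "has_partial i g g'"
  shows "has_partial i (\<lambda>x. f x * g x) (\<lambda>x. f x * g' x + f' x * g x)"
  unfolding has_partial_def
proof
  fix x
  show "((\<lambda>u. f (x + u *\<^sub>R axis i 1) * g (x + u *\<^sub>R axis i 1)) has_vector_derivative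
      f x * g' x + f' x * g x) (at 0)"
    using has_vector_derivative_mult[OF assms[unfolded has_partial_def, rule_format, of x]]
    by simp
qed

lemma has_partial_const: "has_partial i (\<lambda>x. c) (\<lambda>x. 0)"
  unfolding has_partial_def by simp

lemma has_partial_cnj: "has_partial i f f' \<Longrightarrow> has_partial i (\<lambda>x. cnj (f x)) (\<lambda>x. cnj (f' x))"
  unfolding has_partial_def by (intro allI has_vector_derivative_cnj) blast

lemma has_partial_echar: "has_partial i (echar k) (\<lambda>x. (2 * pi * k $ i) *\<^sub>R (\<i> * echar k x))"
  unfolding has_partial_def
proof
  fix x
  have *: "((\<lambda>u. cis (2 * pi * (k \<bullet> x) + u * (2 * pi * k $ i))) has_vector_derivative
      (2 * pi * k $ i) *\<^sub>R (\<i> * cis (2 * pi * (k \<bullet> x)))) (at 0)"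
    unfolding has_vector_derivative_def
    by (auto intro!: derivative_eq_intros simp: mult_ac)
  have "echar k (x + u *\<^sub>R axis i 1) = cis (2 * pi * (k \<bullet> x) + u * (2 * pi * k $ i))" for u
    by (simp add: echar_def inner_add_right inner_axis algebra_simps)
  with * show "((\<lambda>u. echar k (x + u *\<^sub>R axis i 1)) has_vector_derivative
      (2 * pi * k $ i) *\<^sub>R (\<i> * echar k x)) (at 0)"
    by (simp add: echar_def)
qed

lemma exp_sum_has_partial:
  assumes "exp_sum L f"
  shows "has_partial i f (partial_deriv i f) \<and> exp_sum L (partial_deriv i f)"
proof -
  have "\<exists>g. has_partial i f g \<and> exp_sum L g"
    using assms
  proof (induction rule: exp_sum.induct)
    case zero
    show ?case using has_partial_const exp_sum.zero by blast
  next
    case (step f k c)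
    then obtain g where g: "has_partial i f g" "exp_sum L g" by blast
    have "has_partial i (\<lambda>x. f x + c * echar k x)
        (\<lambda>x. g x + (c * (2 * pi * k $ i) * \<i>) * echar k x)"
      using has_partial_add[OF g(1) has_partial_mult[OF has_partial_const has_partial_echar], of c k]
      by (simp add: scaleR_conv_of_real mult_ac)
    moreover have "exp_sum L (\<lambda>x. g x + (c * (2 * pi * k $ i) * \<i>) * echar k x)"
      using g(2) step.hyps(2) by (rule exp_sum.step)
    ultimately show ?case by blast
  qed
  then show ?thesis using has_partial_eq by blast
qed

lemmas has_partial_exp_sum = exp_sum_has_partial[THEN conjunct1]
lemmas exp_sum_partial_deriv = exp_sum_has_partial[THEN conjunct2]

lemma partial_deriv_zero [simp]: "partial_deriv i (\<lambda>_. 0) = (\<lambda>_. 0)"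
  by (rule has_partial_eq) (rule has_partial_const)

lemma partial_deriv_step:
  assumes "exp_sum L f"
  shows "partial_deriv i (\<lambda>x. f x + c * echar k x) =
    (\<lambda>x. partial_deriv i f x + (c * (2 * pi * k $ i) * \<i>) * echar k x)"
  using has_partial_eq[OF has_partial_add[OF has_partial_exp_sum[OF assms, of i]
    has_partial_mult[OF has_partial_const has_partial_echar]], of c k]
  by (simp add: scaleR_conv_of_real mult_ac)

lemma partial_deriv_commute:
  "exp_sum L f \<Longrightarrow> partial_deriv i (partial_deriv j f) = partial_deriv j (partial_deriv i f)"
proof (induction rule: exp_sum.induct)
  case (step f k c)
  show ?case
    unfolding partial_deriv_step[OF step.hyps(1)]
      partial_deriv_step[OF exp_sum_partial_deriv[OF step.hyps(1)]] step.IH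
    by (simp add: mult_ac)
qed simp

lemma vanishes_to_order_0 [simp]: "vanishes_to_order 0 f x"
  by (simp add: Delta_def)

text \<open>
  This recursion in the order is what makes the Leibniz and chain rules below short inductions
  without any multi-index formula. It needs the partial derivatives to commute, since
  \<^term>\<open>mixed_partial\<close> applies them in a fixed order.
\<close>
lemma vanishes_to_order_Suc:
  assumes "exp_sum L f"
  shows "vanishes_to_order (Suc n) f x \<longleftrightarrow>
    f x = 0 \<and> (\<forall>i. vanishes_to_order n (partial_deriv i f) x)"
proof -
  have comm: "(partial_deriv 2 ^^ b) (partial_deriv 1 f) = partial_deriv 1 ((partial_deriv 2 ^^ b) f) \<and>
      exp_sum L ((partial_deriv 2 ^^ b) f)" for b
    by (induction b) (auto simp: assms exp_sum_partial_deriv intro: partial_deriv_commute)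
  have d1: "mixed_partial (a, b) (partial_deriv 1 f) = mixed_partial (Suc a, b) f" for a b
    using comm[of b] by (simp add: mixed_partial_def funpow_swap1)
  have d2: "mixed_partial (a, b) (partial_deriv 2 f) = mixed_partial (a, Suc b) f" for a b
    by (simp add: mixed_partial_def funpow_swap1)
  show ?thesis
  proof (intro iffI conjI allI ballI)
    assume v: "vanishes_to_order (Suc n) f x"
    have "mixed_partial (0, 0) f x = 0" using v by (auto simp: Delta_def)
    then show "f x = 0" by (simp add: mixed_partial_def)
    fix i :: 2 and \<beta> assume "\<beta> \<in> Delta n"
    then obtain a b where \<beta>: "\<beta> = (a, b)" "(Suc a, b) \<in> Delta (Suc n)" "(a, Suc b) \<in> Delta (Suc n)"
      by (auto simp: Delta_def)
    show "mixed_partial \<beta> (partial_deriv i f) x = 0"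
      using v \<beta> d1 d2 exhaust_2[of i] by auto
  next
    fix \<beta> assume r: "f x = 0 \<and> (\<forall>i. vanishes_to_order n (partial_deriv i f) x)" and "\<beta> \<in> Delta (Suc n)"
    then consider "\<beta> = (0, 0)" | a b where "\<beta> = (Suc a, b)" "(a, b) \<in> Delta n"
      | a b where "\<beta> = (a, Suc b)" "(a, b) \<in> Delta n"
      by (cases "\<beta>"; cases "fst \<beta>"; cases "snd \<beta>") (auto simp: Delta_def)
    then show "mixed_partial \<beta> f x = 0"
    proof cases
      case 1
      with r show ?thesis by (simp add: mixed_partial_def)
    next
      case 2
      with r show ?thesis by (simp flip: d1)
    next
      case 3
      with r show ?thesis by (simp flip: d2)
    qed
  qed
qed

lemma vanishes_to_order_mono: "vanishes_to_order n f x \<Longrightarrow> k \<le> n \<Longrightarrow> vanishes_to_order k f x"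
  by (auto simp: Delta_def)

lemma vanishes_to_order_zero: "vanishes_to_order n (\<lambda>_. 0) x"
  by (induction n) (simp_all add: vanishes_to_order_Suc[OF exp_sum.zero])

lemma vanishes_to_order_add:
  "exp_sum L f \<Longrightarrow> exp_sum L g \<Longrightarrow> vanishes_to_order n f x \<Longrightarrow> vanishes_to_order n g x \<Longrightarrow>
    vanishes_to_order n (\<lambda>\<xi>. f \<xi> + g \<xi>) x"
proof (induction n arbitrary: f g)
  case (Suc n)
  have "partial_deriv i (\<lambda>\<xi>. f \<xi> + g \<xi>) = (\<lambda>\<xi>. partial_deriv i f \<xi> + partial_deriv i g \<xi>)" for i
    by (intro has_partial_eq has_partial_add has_partial_exp_sum[OF Suc.prems(1)]
      has_partial_exp_sum[OF Suc.prems(2)])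
  moreover have "vanishes_to_order n (\<lambda>\<xi>. partial_deriv i f \<xi> + partial_deriv i g \<xi>) x" for i
    using Suc.prems by (intro Suc.IH exp_sum_partial_deriv) (simp_all add: vanishes_to_order_Suc)
  ultimately show ?case
    using Suc.prems
    by (simp add: vanishes_to_order_Suc vanishes_to_order_Suc[OF exp_sum_add[OF Suc.prems(1,2)]])
qed simp

lemma vanishes_to_order_mult:
  "exp_sum UNIV f \<Longrightarrow> exp_sum UNIV g \<Longrightarrow> vanishes_to_order n f x \<Longrightarrow>
    vanishes_to_order n (\<lambda>\<xi>. f \<xi> * g \<xi>) x"
proof (induction n arbitrary: f g)
  case (Suc n)
  have "partial_deriv i (\<lambda>\<xi>. f \<xi> * g \<xi>) =
      (\<lambda>\<xi>. f \<xi> * partial_deriv i g \<xi> + partial_deriv i f \<xi> * g \<xi>)" for i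
    by (intro has_partial_eq has_partial_mult has_partial_exp_sum[OF Suc.prems(1)]
      has_partial_exp_sum[OF Suc.prems(2)])
  moreover have "vanishes_to_order n (\<lambda>\<xi>. f \<xi> * partial_deriv i g \<xi> + partial_deriv i f \<xi> * g \<xi>) x" for i
    using Suc.prems vanishes_to_order_mono[OF Suc.prems(3), of n]
    by (intro vanishes_to_order_add[of UNIV] Suc.IH exp_sum_mult[of UNIV _ UNIV] exp_sum_partial_deriv)
       (simp_all add: vanishes_to_order_Suc)
  ultimately show ?case
    using Suc.prems vanishes_to_order_Suc[OF exp_sum_mult[OF Suc.prems(1,2) UNIV_I]]
    by (simp add: vanishes_to_order_Suc)
qed simp

lemma vanishes_to_order_sum:
  assumes "\<And>i. i \<in> I \<Longrightarrow> exp_sum L (f i)" "\<And>i. i \<in> I \<Longrightarrow> vanishes_to_order n (f i) x"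
  shows "vanishes_to_order n (\<lambda>\<xi>. \<Sum>i\<in>I. f i \<xi>) x"
  using assms
proof (induction I rule: infinite_finite_induct)
  case (insert i I)
  then show ?case
    using vanishes_to_order_add[of L "f i" "\<lambda>\<xi>. \<Sum>i\<in>I. f i \<xi>" n x] by (simp add: exp_sum_sum)
qed (simp_all add: vanishes_to_order_zero)

lemma vanishes_to_order_cmult:
  "exp_sum UNIV f \<Longrightarrow> vanishes_to_order n f x \<Longrightarrow> vanishes_to_order n (\<lambda>\<xi>. c * f \<xi>) x"
  using vanishes_to_order_mult[OF _ exp_sum_const[of UNIV c], of f n x] by (simp add: mult.commute)

lemma vanishes_to_order_cnj:
  "exp_sum UNIV f \<Longrightarrow> vanishes_to_order n f x \<Longrightarrow> vanishes_to_order n (\<lambda>\<xi>. cnj (f \<xi>)) x"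
proof (induction n arbitrary: f)
  case (Suc n)
  have "partial_deriv i (\<lambda>\<xi>. cnj (f \<xi>)) = (\<lambda>\<xi>. cnj (partial_deriv i f \<xi>))" for i
    by (intro has_partial_eq has_partial_cnj has_partial_exp_sum[OF Suc.prems(1)])
  moreover have "vanishes_to_order n (\<lambda>\<xi>. cnj (partial_deriv i f \<xi>)) x" for i
    using Suc.prems by (intro Suc.IH exp_sum_partial_deriv) (simp_all add: vanishes_to_order_Suc)
  ultimately show ?case
    using Suc.prems vanishes_to_order_Suc[OF exp_sum_cnj[OF Suc.prems(1) UNIV_I]]
    by (simp add: vanishes_to_order_Suc)
qed simp

lemma partial_deriv_affine:
  assumes "exp_sum L f"
  shows "partial_deriv i (\<lambda>\<xi>. f (A *v \<xi> + b)) =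
    (\<lambda>\<xi>. \<Sum>j\<in>UNIV. complex_of_real (A $ j $ i) * partial_deriv j f (A *v \<xi> + b))"
  using assms
proof (induction rule: exp_sum.induct)
  case zero
  show ?case by simp
next
  case (step f k c)
  have f: "exp_sum UNIV (\<lambda>\<xi>. f (A *v \<xi> + b))"
    by (rule exp_sum_affine[OF step.hyps(1)]) simp
  have e: "echar k (A *v \<xi> + b) = echar k b * echar (transpose A *v k) \<xi>" for \<xi>
    by (simp add: echar_add_right echar_matrix)
  have "partial_deriv i (\<lambda>\<xi>. f (A *v \<xi> + b) + c * echar k (A *v \<xi> + b)) =
      (\<lambda>\<xi>. partial_deriv i (\<lambda>\<xi>. f (A *v \<xi> + b)) \<xi> +
        c * (2 * pi * (transpose A *v k) $ i) * \<i> * echar k (A *v \<xi> + b))"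
    using partial_deriv_step[OF f, of i "c * echar k b" "transpose A *v k"]
    by (simp add: e mult_ac)
  moreover have "(transpose A *v k) $ i = (\<Sum>j\<in>UNIV. A $ j $ i * k $ j)"
    by (simp add: matrix_vector_mult_def transpose_def)
  ultimately show ?case
    by (simp add: partial_deriv_step[OF step.hyps(1)] step.IH ring_distribs sum.distrib
      sum_distrib_left sum_distrib_right mult_ac)
qed

lemma vanishes_to_order_affine:
  "exp_sum UNIV f \<Longrightarrow> vanishes_to_order n f (A *v x + b) \<Longrightarrow>
    vanishes_to_order n (\<lambda>\<xi>. f (A *v \<xi> + b)) x"
proof (induction n arbitrary: f)
  case (Suc n)
  have aff: "exp_sum UNIV (\<lambda>\<xi>. g (A *v \<xi> + b))" if "exp_sum UNIV g" for g
    using that by (rule exp_sum_affine) simp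
  have "vanishes_to_order n (\<lambda>\<xi>. \<Sum>j\<in>UNIV. complex_of_real (A $ j $ i) *
      partial_deriv j f (A *v \<xi> + b)) x" for i
    using Suc.prems
    by (intro vanishes_to_order_sum[of _ UNIV] vanishes_to_order_cmult exp_sum_cmult aff Suc.IH
      exp_sum_partial_deriv) (simp_all add: vanishes_to_order_Suc)
  with Suc.prems show ?case
    by (simp add: vanishes_to_order_Suc vanishes_to_order_Suc[OF aff] partial_deriv_affine)
qed simp

section \<open>Residues modulo a diagonal lattice\<close>

definition digit_box :: "int ^ 2 \<Rightarrow> (int ^ 2) set" where
  "digit_box N = {v. \<forall>i. 0 \<le> v $ i \<and> v $ i < N $ i}"

definition residue :: "int ^ 2 \<Rightarrow> int ^ 2 \<Rightarrow> int ^ 2" where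
  "residue N k = (\<chi> i. k $ i mod N $ i)"

definition signs :: "(int ^ 2) set" where
  "signs = {e. \<forall>i. e $ i = 1 \<or> e $ i = - 1}"

lemma digit_box_eq_image: "digit_box N = vec_lambda ` (\<Pi>\<^sub>E i\<in>UNIV. {0..<N $ i})"
proof (intro equalityI subsetI)
  fix v assume "v \<in> digit_box N"
  then have "v = vec_lambda (vec_nth v)" "vec_nth v \<in> (\<Pi>\<^sub>E i\<in>UNIV. {0..<N $ i})"
    by (auto simp: digit_box_def PiE_UNIV_domain)
  then show "v \<in> vec_lambda ` (\<Pi>\<^sub>E i\<in>UNIV. {0..<N $ i})" by blast
qed (auto simp: digit_box_def PiE_UNIV_domain)

lemma finite_box [simp]: "finite (digit_box N)"
  unfolding digit_box_eq_image by (intro finite_imageI finite_PiE) auto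

lemma sum_box_prod:
  fixes f :: "2 \<Rightarrow> int \<Rightarrow> 'a :: comm_semiring_1"
  shows "(\<Sum>v\<in>digit_box N. \<Prod>i\<in>UNIV. f i (v $ i)) = (\<Prod>i\<in>UNIV. \<Sum>x\<in>{0..<N $ i}. f i x)"
proof -
  have "inj_on vec_lambda (\<Pi>\<^sub>E i\<in>UNIV. {0..<N $ i})"
    by (auto simp: inj_on_def vec_lambda_inject)
  then show ?thesis
    by (simp add: digit_box_eq_image sum.reindex prod_sum_PiE)
qed

lemma card_box: "card (digit_box N) = (\<Prod>i\<in>UNIV. nat (N $ i))"
  using sum_box_prod[where N = N and f = "\<lambda>_ _. 1 :: nat"] by simp

locale positive_moduli =
  fixes N :: "int ^ 2"
  assumes N_pos: "\<And>i. 0 < N $ i"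
begin

lemma residue_in_box: "residue N k \<in> digit_box N"
  using N_pos by (simp add: digit_box_def residue_def)

lemma residue_eq_iff:
  assumes "v \<in> digit_box N"
  shows "residue N k = v \<longleftrightarrow> (\<forall>i. N $ i dvd k $ i - v $ i)"
proof -
  have "v $ i mod N $ i = v $ i" for i using assms by (simp add: digit_box_def)
  then show ?thesis
    unfolding vec_eq_iff residue_def mod_eq_dvd_iff[symmetric] by simp
qed

lemma residue_mult_involution:
  assumes "e \<in> signs" "v \<in> digit_box N"
  shows "residue N (e * residue N (e * v)) = v"
proof -
  have e: "e $ i = 1 \<or> e $ i = - 1" for i using assms(1) by (simp add: signs_def)
  have "(e $ i * (e $ i * v $ i mod N $ i)) mod N $ i = (e $ i * (e $ i * v $ i)) mod N $ i" for i
    by (rule mod_mult_right_eq)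
  moreover have "e $ i * (e $ i * v $ i) = v $ i" for i using e[of i] by auto
  moreover have "v $ i mod N $ i = v $ i" for i using assms(2) by (simp add: digit_box_def)
  ultimately show ?thesis by (simp add: residue_def vec_eq_iff)
qed

lemma sum_box_flip:
  assumes "e \<in> signs"
  shows "(\<Sum>v\<in>digit_box N. g (residue N (e * v))) = (\<Sum>v\<in>digit_box N. g v)"
  by (rule sum.reindex_bij_witness[of _ "\<lambda>v. residue N (e * v)" "\<lambda>v. residue N (e * v)"])
     (use assms residue_mult_involution residue_in_box in auto)

end

section \<open>A symmetric orthogonal transform\<close>

text \<open>
  For fixed \<open>n\<close>, this is a real orthogonal \<open>n \<times> n\<close> matrix. Row \<open>a\<close> lists the coefficients of a
  univariate polynomial that the substitution \<open>x \<mapsto> x\<^sup>-\<^sup>1\<close> reproduces up to a sign and a power of \<open>x\<close>: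
  a monomial \<open>x\<^sup>a\<close> if the residue class of \<open>a\<close> is its own negative, and otherwise
  \<open>(x\<^sup>a \<plusminus> x\<^bsup>n - a\<^esup>) / \<surd>2\<close>, where the two members \<open>a\<close> and \<open>n - a\<close> of the pair share out the signs.
\<close>
definition fold_coeff :: "int \<Rightarrow> int \<Rightarrow> int \<Rightarrow> real" where
  "fold_coeff n a r =
     (if a = 0 \<or> 2 * a = n then of_bool (r = a)
      else (of_bool (r = a) + (if 2 * a < n then 1 else -1) * of_bool (r = n - a)) / sqrt 2)"

lemma fold_coeff_support:
  assumes "fold_coeff n a r \<noteq> 0"
  shows "r = a \<or> r = n - a \<and> a \<noteq> 0"
  using assms by (auto simp: fold_coeff_def split: if_splits)

text \<open>
  Pairing \<open>r\<close> with \<open>n - r\<close> splits the matrix into blocks of size one with entry \<open>1\<close> and blocks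
  of size two, which are rotations by \<open>\<pi> / 4\<close>.
\<close>
lemma fold_coeff_orthogonal:
  assumes "r \<in> {0..<n}" "r' \<in> {0..<n}"
  shows "(\<Sum>a\<in>{0..<n}. fold_coeff n a r * fold_coeff n a r') = of_bool (r = r')"
proof (cases "r = 0 \<or> 2 * r = n")
  case True
  then have "(\<Sum>a\<in>{0..<n}. fold_coeff n a r * fold_coeff n a r') =
      (\<Sum>a\<in>{r}. fold_coeff n a r * fold_coeff n a r')"
    using assms by (intro sum.mono_neutral_right) (auto simp: fold_coeff_def)
  also have "\<dots> = of_bool (r = r')" using True by (simp add: fold_coeff_def)
  finally show ?thesis .
next
  case False
  then have "(\<Sum>a\<in>{0..<n}. fold_coeff n a r * fold_coeff n a r') =
      (\<Sum>a\<in>{r, n - r}. fold_coeff n a r * fold_coeff n a r')"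
    using assms by (intro sum.mono_neutral_right) (auto simp: fold_coeff_def)
  also have "\<dots> = fold_coeff n r r * fold_coeff n r r' +
      fold_coeff n (n - r) r * fold_coeff n (n - r) r'"
    using False by (subst sum.insert) auto
  also have "\<dots> = of_bool (r = r')"
    using False assms by (auto simp: fold_coeff_def)
  finally show ?thesis .
qed

definition fold_sign :: "int \<Rightarrow> int \<Rightarrow> int \<Rightarrow> real" where
  "fold_sign n e a = (if e = - 1 \<and> n < 2 * a then - 1 else 1)"

lemma fold_coeff_flip:
  assumes "e = 1 \<or> e = - 1" "a \<in> {0..<n}" "r \<in> {0..<n}"
  shows "fold_coeff n a (e * r mod n) = fold_sign n e a * fold_coeff n a r"
proof (cases "e = 1")
  case True
  then show ?thesis using assms(3) by (simp add: fold_sign_def)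
next
  case False
  have "(- r) mod n = (if r = 0 then 0 else n - r)"
    using assms(3) by (auto simp: zmod_zminus1_eq_if)
  then have "fold_coeff n a (e * r mod n) = fold_coeff n a (if r = 0 then 0 else n - r)"
    using assms(1) False by auto
  also have "\<dots> = fold_sign n e a * fold_coeff n a r"
    using assms False unfolding fold_coeff_def fold_sign_def by simp
  finally show ?thesis .
qed

text \<open>
  Where row \<open>a\<close> does not vanish, reducing \<open>e r\<close> to its residue moves it by an amount that depends
  on \<open>a\<close> and \<open>e\<close> but not on \<open>r\<close>: the frequencies in row \<open>a\<close> lie symmetrically about \<open>n / 2\<close>, or
  at \<open>0\<close> if \<open>a = 0\<close>. This common shift is what makes the centre of the row a well-defined point.
\<close>
lemma fold_coeff_centre:
  assumes "e = 1 \<or> e = - 1" "a \<in> {0..<n}" "r \<in> {0..<n}" "fold_coeff n a r \<noteq> 0"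
  shows "real_of_int (e * r - e * r mod n) =
    e * (if a = 0 then 0 else n / 2) - (if a = 0 then 0 else n / 2)"
proof -
  have "(- r) mod n = (if r = 0 then 0 else n - r)"
    using assms(3) by (auto simp: zmod_zminus1_eq_if)
  moreover have "r mod n = r" using assms(3) by simp
  ultimately show ?thesis
    using assms(1-3) fold_coeff_support[OF assms(4)] by (cases "e = 1") auto
qed

definition fold_matrix :: "int ^ 2 \<Rightarrow> int ^ 2 \<Rightarrow> int ^ 2 \<Rightarrow> real" where
  "fold_matrix N a v = (\<Prod>i\<in>UNIV. fold_coeff (N $ i) (a $ i) (v $ i))"

definition fold_centre :: "int ^ 2 \<Rightarrow> int ^ 2 \<Rightarrow> real ^ 2" where
  "fold_centre N a = (\<chi> i. if a $ i = 0 then 0 else N $ i / 2)"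

context positive_moduli
begin

lemma fold_matrix_orthogonal:
  assumes "v \<in> digit_box N" "v' \<in> digit_box N"
  shows "(\<Sum>a\<in>digit_box N. fold_matrix N a v * fold_matrix N a v') = of_bool (v = v')"
proof -
  have "(\<Sum>a\<in>digit_box N. fold_matrix N a v * fold_matrix N a v') = (\<Prod>i\<in>UNIV. of_bool (v $ i = v' $ i))"
    unfolding fold_matrix_def prod.distrib[symmetric]
      sum_box_prod[where N = N and f = "\<lambda>i x. fold_coeff (N $ i) x (v $ i) * fold_coeff (N $ i) x (v' $ i)"]
    using assms by (intro prod.cong fold_coeff_orthogonal refl) (auto simp: digit_box_def)
  also have "\<dots> = of_bool (v = v')" by (auto simp: vec_eq_iff)
  finally show ?thesis .
qed

text \<open>
  A reflection permutes the digits up to lattice vectors. If the factors \<open>F\<close> follow this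
  permutation, then combining them with a row of the matrix gives an axially (anti)symmetric
  function: the row contributes the sign, and the lattice vectors lost in the reduction
  contribute the factor with the centre.
\<close>
lemma fold_combination_symmetric:
  assumes "e \<in> signs" "a \<in> digit_box N"
    and F: "\<And>v \<xi>. v \<in> digit_box N \<Longrightarrow> F (residue N (e * v)) \<xi> = F v (rvec e * \<xi>)"
  defines "t \<equiv> \<lambda>\<xi>. \<Sum>v\<in>digit_box N. complex_of_real (fold_matrix N a v) * echar (rvec v) \<xi> * F v \<xi>"
  shows "\<exists>\<epsilon>\<in>{1, -1}. \<forall>\<xi>. t \<xi> =
    \<epsilon> * echar (fold_centre N a - rvec e * fold_centre N a) \<xi> * t (rvec e * \<xi>)"
proof -
  define \<epsilon> where "\<epsilon> = (\<Prod>i\<in>UNIV. fold_sign (N $ i) (e $ i) (a $ i))"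
  define c where "c = fold_centre N a"
  have eps: "\<epsilon> = 1 \<or> \<epsilon> = - 1" by (simp add: \<epsilon>_def UNIV_2 fold_sign_def)
  have e: "e $ i = 1 \<or> e $ i = - 1" for i using assms(1) by (auto simp: signs_def)
  have sym: "fold_matrix N a v = \<epsilon> * fold_matrix N a (residue N (e * v))" if "v \<in> digit_box N" for v
  proof -
    have "fold_matrix N a (residue N (e * v)) = \<epsilon> * fold_matrix N a v"
      unfolding fold_matrix_def \<epsilon>_def prod.distrib[symmetric]
      using assms(2) that e
      by (intro prod.cong refl) (auto simp: residue_def digit_box_def intro!: fold_coeff_flip)
    with eps show ?thesis by auto
  qed
  have shift: "rvec e * rvec v = rvec (residue N (e * v)) + (rvec e * c - c)"
    if "v \<in> digit_box N" "fold_matrix N a v \<noteq> 0" for v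
  proof -
    have "fold_coeff (N $ i) (a $ i) (v $ i) \<noteq> 0" for i
      using that(2) by (simp add: fold_matrix_def)
    then have "real_of_int (e $ i * v $ i - e $ i * v $ i mod N $ i) = e $ i * c $ i - c $ i" for i
      using fold_coeff_centre[OF e, of "a $ i" "N $ i" "v $ i" i] assms(2) that(1)
      by (auto simp: digit_box_def c_def fold_centre_def)
    then have "real_of_int (e $ i) * real_of_int (v $ i) =
        real_of_int (e $ i * v $ i mod N $ i) + (e $ i * c $ i - c $ i)" for i
      by (simp add: algebra_simps)
    then show ?thesis by (simp add: vec_eq_iff residue_def)
  qed
  have echar_flip: "echar x (rvec e * \<xi>) = echar (rvec e * x) \<xi>" for x \<xi>
    by (simp add: echar_def inner_vec_def mult_ac)
  have "t (rvec e * \<xi>) = \<epsilon> * echar (rvec e * c - c) \<xi> * t \<xi>" for \<xi>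
  proof -
    define g where "g v = complex_of_real (fold_matrix N a v) * echar (rvec v) \<xi> * F v \<xi>" for v
    have "t (rvec e * \<xi>) =
        (\<Sum>v\<in>digit_box N. \<epsilon> * echar (rvec e * c - c) \<xi> * g (residue N (e * v)))"
      unfolding t_def
    proof (intro sum.cong refl)
      fix v assume v: "v \<in> digit_box N"
      show "fold_matrix N a v * echar (rvec v) (rvec e * \<xi>) * F v (rvec e * \<xi>) =
          \<epsilon> * echar (rvec e * c - c) \<xi> * g (residue N (e * v))"
      proof (cases "fold_matrix N a v = 0")
        case True
        then show ?thesis using sym[OF v] eps by (auto simp: g_def)
      next
        case False
        show ?thesis
          unfolding echar_flip shift[OF v False] echar_add g_def F[OF v]
          by (subst sym[OF v]) (simp add: mult_ac)
      qed
    qed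
    also have "\<dots> = \<epsilon> * echar (rvec e * c - c) \<xi> * (\<Sum>v\<in>digit_box N. g (residue N (e * v)))"
      by (simp add: sum_distrib_left)
    also have "\<dots> = \<epsilon> * echar (rvec e * c - c) \<xi> * (\<Sum>v\<in>digit_box N. g v)"
      by (simp only: sum_box_flip[OF assms(1)])
    finally show ?thesis by (simp add: g_def t_def)
  qed
  moreover have "echar (c - rvec e * c) \<xi> * echar (rvec e * c - c) \<xi> = 1" for \<xi>
    by (simp flip: echar_add)
  moreover have "complex_of_real \<epsilon> * complex_of_real \<epsilon> = 1" using eps by auto
  moreover have "\<epsilon> * echar (c - rvec e * c) \<xi> * (\<epsilon> * echar (rvec e * c - c) \<xi> * t \<xi>) =
      (complex_of_real \<epsilon> * complex_of_real \<epsilon>) *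
      (echar (c - rvec e * c) \<xi> * echar (rvec e * c - c) \<xi>) * t \<xi>" for \<xi>
    by (simp only: mult_ac)
  ultimately have "\<epsilon> * echar (c - rvec e * c) \<xi> * t (rvec e * \<xi>) = t \<xi>" for \<xi>
    by (simp only: mult_1_left)
  with eps show ?thesis
    by (intro bexI[of _ "complex_of_real \<epsilon>"]) (auto simp flip: c_def)
qed

end

section \<open>Splitting by cosets\<close>

definition dual_point :: "int ^ 2 \<Rightarrow> int ^ 2 \<Rightarrow> real ^ 2" where
  "dual_point N p = (\<chi> i. p $ i / N $ i)"

text \<open>
  Averaging over the shifts by dual lattice points against a character keeps exactly the
  frequencies congruent to \<open>v\<close>. A definition by values rather than by coefficients gives the
  behaviour under reflections and near the origin from that of the function, without any appeal
  to the uniqueness of the coefficients.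
\<close>
definition coset_part ::
    "int ^ 2 \<Rightarrow> (real ^ 2 \<Rightarrow> complex) \<Rightarrow> int ^ 2 \<Rightarrow> real ^ 2 \<Rightarrow> complex" where
  "coset_part N f v \<xi> =
     (\<Sum>p\<in>digit_box N. cnj (echar (rvec v) (dual_point N p)) * f (\<xi> + dual_point N p)) /
     of_nat (card (digit_box N))"

definition coset_frequencies :: "int ^ 2 \<Rightarrow> int ^ 2 \<Rightarrow> (real ^ 2) set" where
  "coset_frequencies N v = {rvec k | k. \<forall>i. N $ i dvd k $ i - v $ i}"

lemma echar_eq_1: "x \<bullet> \<xi> \<in> \<int> \<Longrightarrow> echar x \<xi> = 1"
  unfolding echar_def by (rule cis_multiple_2pi)

lemma sum_cis_int:
  assumes "0 < (n :: int)"
  shows "(\<Sum>x\<in>{0..<n}. cis (2 * pi * (real_of_int j * (real_of_int x / real_of_int n)))) =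
    (if n dvd j then of_int n else 0)"
proof -
  define m where "m = nat n"
  have n: "n = int m" and m: "0 < m" using assms by (auto simp: m_def)
  define z where "z = cis (2 * pi * (real_of_int j / real m))"
  have power: "z ^ nat x = cis (2 * pi * (real_of_int j * (real_of_int x / real m)))"
    if "0 \<le> x" for x
  proof -
    have "real (nat x) = real_of_int x" using that by simp
    then show ?thesis unfolding z_def Complex.DeMoivre by (simp add: mult_ac)
  qed
  have "(\<Sum>x\<in>{0..<n}. cis (2 * pi * (real_of_int j * (real_of_int x / real_of_int n)))) =
      (\<Sum>x<m. z ^ x)"
    by (rule sum.reindex_bij_witness[of _ int nat]) (auto simp: n power)
  also have "\<dots> = (if n dvd j then of_int n else 0)"
  proof (cases "n dvd j")
    case True
    then obtain q where "j = n * q" by blast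
    then have "z = cis (2 * pi * real_of_int q)" using m by (simp add: z_def n)
    then have "z = 1" by (simp only: cis_multiple_2pi Ints_of_int)
    with True show ?thesis by (simp add: n)
  next
    case False
    have "z \<noteq> 1"
    proof
      assume "z = 1"
      then have "cos (2 * pi * (real_of_int j / real m)) = 1"
        unfolding z_def by (metis cis.simps(1) one_complex.simps(1))
      then obtain q :: int where "2 * pi * (real_of_int j / real m) = real_of_int q * 2 * pi"
        unfolding cos_one_2pi_int by blast
      then have "real_of_int j = real_of_int (q * int m)" using m by (simp add: field_simps)
      then have "j = q * n" unfolding n by (simp only: of_int_eq_iff)
      with False show False by simp
    qed
    have "z ^ m = cis (2 * pi * real_of_int j)"
      unfolding z_def Complex.DeMoivre using m by (simp add: field_simps)
    then have "z ^ m = 1" by (simp only: cis_multiple_2pi Ints_of_int)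
    with \<open>z \<noteq> 1\<close> False show ?thesis by (simp add: geometric_sum)
  qed
  finally show ?thesis .
qed

context positive_moduli
begin

lemma card_digit_box_pos: "0 < card (digit_box N)"
  using N_pos by (simp add: card_box)

lemma echar_dual_point:
  assumes "\<And>i. N $ i dvd k $ i"
  shows "echar (rvec k) (dual_point N p) = 1"
proof (rule echar_eq_1)
  have "real_of_int (k $ i) * (p $ i / N $ i) \<in> \<int>" for i
  proof -
    obtain q where "k $ i = N $ i * q" using assms by (blast elim: dvdE)
    then show ?thesis using N_pos[of i] by simp
  qed
  then show "rvec k \<bullet> dual_point N p \<in> \<int>"
    by (auto simp: inner_vec_def dual_point_def intro!: Ints_sum)
qed

lemma sum_echar_dual_point:
  "(\<Sum>p\<in>digit_box N. echar (rvec k) (dual_point N p)) =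
    (if \<forall>i. N $ i dvd k $ i then of_nat (card (digit_box N)) else 0)"
proof -
  have "echar (rvec k) (dual_point N p) =
      (\<Prod>i\<in>UNIV. cis (2 * pi * (real_of_int (k $ i) * (real_of_int (p $ i) / real_of_int (N $ i)))))" for p
    by (simp add: echar_def dual_point_def inner_vec_def UNIV_2 cis_mult ring_distribs)
  then have "(\<Sum>p\<in>digit_box N. echar (rvec k) (dual_point N p)) =
      (\<Prod>i\<in>UNIV. if N $ i dvd k $ i then of_int (N $ i) else 0)"
    unfolding sum_cis_int[OF N_pos, symmetric]
    using sum_box_prod[where N = N and f = "\<lambda>i x.
      cis (2 * pi * (real_of_int (k $ i) * (real_of_int x / real_of_int (N $ i))))"]
    by (simp only:)
  then show ?thesis
    using N_pos by (auto simp: card_box UNIV_2 forall_2 less_imp_le)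
qed

lemma coset_part_zero: "coset_part N (\<lambda>_. 0) v = (\<lambda>_. 0)"
  by (simp add: coset_part_def fun_eq_iff)

lemma coset_part_echar:
  "coset_part N (echar (rvec k)) v \<xi> =
    (if \<forall>i. N $ i dvd k $ i - v $ i then echar (rvec k) \<xi> else 0)"
proof -
  have "cnj (echar (rvec v) p) * echar (rvec k) (\<xi> + p) = echar (rvec k) \<xi> * echar (rvec (k - v)) p" for p
    unfolding rvec_diff echar_diff echar_add_right by simp
  then have "coset_part N (echar (rvec k)) v \<xi> = echar (rvec k) \<xi> *
      (\<Sum>p\<in>digit_box N. echar (rvec (k - v)) (dual_point N p)) / of_nat (card (digit_box N))"
    by (simp only: coset_part_def sum_distrib_left)
  then show ?thesis
    unfolding sum_echar_dual_point using card_digit_box_pos by auto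
qed

lemma coset_part_step:
  "coset_part N (\<lambda>\<xi>. f \<xi> + c * g \<xi>) v \<xi> = coset_part N f v \<xi> + c * coset_part N g v \<xi>"
  by (simp add: coset_part_def ring_distribs sum.distrib sum_distrib_left add_divide_distrib mult_ac)

lemma exp_sum_coset_part:
  "exp_sum integral_vectors f \<Longrightarrow> exp_sum (coset_frequencies N v) (coset_part N f v)"
proof (induction rule: exp_sum.induct)
  case zero
  show ?case by (simp add: coset_part_zero exp_sum.zero)
next
  case (step f k c)
  then obtain j where k: "k = rvec j" by blast
  have eq: "coset_part N (\<lambda>\<xi>. f \<xi> + c * echar k \<xi>) v = (\<lambda>\<xi>. coset_part N f v \<xi> +
      c * (if \<forall>i. N $ i dvd j $ i - v $ i then echar (rvec j) \<xi> else 0))"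
    by (simp add: coset_part_step coset_part_echar k fun_eq_iff)
  show ?case
  proof (cases "\<forall>i. N $ i dvd j $ i - v $ i")
    case True
    then have "rvec j \<in> coset_frequencies N v" by (auto simp: coset_frequencies_def)
    with True step.IH show ?thesis unfolding eq by (simp add: exp_sum.step)
  next
    case False
    then show ?thesis using step.IH unfolding eq by (simp only: if_False) simp
  qed
qed

lemma sum_coset_part:
  "exp_sum integral_vectors f \<Longrightarrow> (\<Sum>v\<in>digit_box N. coset_part N f v \<xi>) = f \<xi>"
proof (induction rule: exp_sum.induct)
  case zero
  show ?case by (simp add: coset_part_zero)
next
  case (step f k c)
  then obtain j where k: "k = rvec j" by blast
  have "(\<Sum>v\<in>digit_box N. coset_part N (echar (rvec j)) v \<xi>) =
      (\<Sum>v\<in>digit_box N. if v = residue N j then echar (rvec j) \<xi> else 0)"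
    by (intro sum.cong refl) (auto simp: coset_part_echar residue_eq_iff[symmetric])
  also have "\<dots> = echar (rvec j) \<xi>"
    using residue_in_box by simp
  finally show ?case
    using step.IH by (simp add: k coset_part_step sum.distrib sum_distrib_left[symmetric])
qed

text \<open>
  A reflection also permutes the dual lattice points modulo integral vectors, so reindexing the
  average by this permutation transports the reflection from the argument to the coset.
\<close>
lemma coset_part_flip:
  assumes f: "exp_sum integral_vectors f" and e: "e \<in> signs" and sym: "\<And>\<xi>. f (rvec e * \<xi>) = f \<xi>"
  shows "coset_part N f (residue N (e * v)) \<xi> = coset_part N f v (rvec e * \<xi>)"
proof -
  have ee: "real_of_int (e $ i) * (real_of_int (e $ i) * x) = x" for i x
    using e by (auto simp: signs_def dest!: spec[of _ i])
  have inv: "rvec e * (rvec e * x) = x" for x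
    by (simp add: vec_eq_iff ee)
  define w where "w = residue N (e * v)"
  have summand: "cnj (echar (rvec w) (dual_point N (residue N (e * p)))) *
      f (\<xi> + dual_point N (residue N (e * p))) =
      cnj (echar (rvec v) (dual_point N p)) * f (rvec e * \<xi> + dual_point N p)" for p
  proof -
    define l where "l = (\<chi> i. (e $ i * p $ i) div N $ i)"
    have l: "rvec e * dual_point N p = dual_point N (residue N (e * p)) + rvec l"
    proof -
      have "real_of_int (e $ i) * (p $ i / N $ i) =
          real_of_int (e $ i * p $ i mod N $ i) / N $ i + real_of_int (e $ i * p $ i div N $ i)" for i
      proof -
        have "real_of_int (e $ i * p $ i) = real_of_int (e $ i * p $ i mod N $ i) +
            real_of_int (N $ i) * real_of_int (e $ i * p $ i div N $ i)"
          by (simp only: of_int_mult[symmetric] of_int_add[symmetric] mod_mult_div_eq)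
        then show ?thesis using N_pos[of i] by (simp add: field_simps)
      qed
      then show ?thesis by (simp add: vec_eq_iff dual_point_def residue_def l_def)
    qed
    have "f (rvec e * \<xi> + dual_point N p) = f (rvec e * (rvec e * \<xi> + dual_point N p))"
      by (simp add: sym)
    also have "\<dots> = f (\<xi> + dual_point N (residue N (e * p)) + rvec l)"
      by (simp only: ring_distribs inv l add.assoc)
    also have "\<dots> = f (\<xi> + dual_point N (residue N (e * p)))"
      by (rule exp_sum_int_periodic[OF f])
    finally have 1: "f (rvec e * \<xi> + dual_point N p) = f (\<xi> + dual_point N (residue N (e * p)))" .
    have "e * v - w = (\<chi> i. e $ i * v $ i - e $ i * v $ i mod N $ i)"
      by (simp add: w_def residue_def vec_eq_iff)
    then have "N $ i dvd (e * v - w) $ i" for i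
      by (simp add: minus_mod_eq_mult_div)
    then have "echar (rvec (e * v - w)) (dual_point N q) = 1" for q
      by (rule echar_dual_point)
    moreover have "rvec (e * v) = rvec (e * v - w) + rvec w" by (simp add: vec_eq_iff)
    ultimately have "echar (rvec w) (dual_point N q) = echar (rvec (e * v)) (dual_point N q)" for q
      by (simp only: echar_add mult_1_left)
    then have "echar (rvec w) (dual_point N (residue N (e * p))) =
        echar (rvec (e * v)) (dual_point N (residue N (e * p)))" .
    also have "\<dots> = echar (rvec (e * v)) (rvec e * dual_point N p)"
      unfolding l echar_add_right echar_integral by simp
    also have "\<dots> = echar (rvec v) (dual_point N p)"
      by (simp add: echar_def inner_vec_def ee mult_ac)
    finally show ?thesis using 1 by simp
  qed
  show ?thesis
    unfolding coset_part_def w_def[symmetric]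
    using sum_box_flip[OF e, of "\<lambda>p. cnj (echar (rvec w) (dual_point N p)) * f (\<xi> + dual_point N p)"]
    by (simp add: summand)
qed

text \<open>
  In the average that defines a coset part, only the shift by \<open>0\<close> survives near the origin. So up
  to order \<open>n\<close> all coset parts agree there with the same multiple of the function; this is the
  form in which the sum rule is used.
\<close>
lemma coset_part_approx:
  assumes f: "exp_sum integral_vectors f"
    and v: "\<And>p. p \<in> digit_box N - {0} \<Longrightarrow> vanishes_to_order n (\<lambda>\<xi>. f (\<xi> + dual_point N p)) 0"
  shows "vanishes_to_order n (\<lambda>\<xi>. f \<xi> - of_nat (card (digit_box N)) * coset_part N f v \<xi>) 0"
proof -
  have f': "exp_sum UNIV (\<lambda>\<xi>. f (\<xi> + b))" for b
    using exp_sum_affine[OF f, of "mat 1" UNIV b] by simp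
  have 0: "dual_point N 0 = 0" by (simp add: dual_point_def vec_eq_iff)
  have "0 \<in> digit_box N" using N_pos by (simp add: digit_box_def)
  then have "(\<Sum>p\<in>digit_box N. g p) = g 0 + (\<Sum>p\<in>digit_box N - {0}. g p)" for g :: "_ \<Rightarrow> complex"
    by (intro sum.remove) auto
  then have "f \<xi> - of_nat (card (digit_box N)) * coset_part N f v \<xi> =
      (\<Sum>p\<in>digit_box N - {0}. - cnj (echar (rvec v) (dual_point N p)) * f (\<xi> + dual_point N p))" for \<xi>
    using card_digit_box_pos \<open>0 \<in> digit_box N\<close> by (auto simp: coset_part_def 0 sum_negf)
  moreover have "vanishes_to_order n (\<lambda>\<xi>. \<Sum>p\<in>digit_box N - {0}.
      - cnj (echar (rvec v) (dual_point N p)) * f (\<xi> + dual_point N p)) 0"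
    by (intro vanishes_to_order_sum[of _ UNIV] vanishes_to_order_cmult exp_sum_cmult f' v)
  ultimately show ?thesis by simp
qed

end

section \<open>Reflections\<close>

definition reflection :: "int ^ 2 \<Rightarrow> real ^ 2 ^ 2" where
  "reflection e = (\<chi> i j. if i = j then real_of_int (e $ i) else 0)"

lemma reflection_vector: "reflection e *v x = rvec e * x"
  by (simp add: reflection_def vec_eq_iff forall_2 matrix_vector_mult_def sum_2)

lemma transpose_reflection: "transpose (reflection e) = reflection e"
  by (auto simp: reflection_def transpose_def vec_eq_iff)

lemma axis_group_eq_reflections: "axis_group = reflection ` signs"
proof -
  have signs: "signs = {vector [1, 1], vector [- 1, - 1], vector [- 1, 1], vector [1, - 1]}"
    by (auto simp: signs_def vec_eq_iff forall_2)
  have "reflection (vector [1, 1]) = mat 1" "reflection (vector [- 1, - 1]) = - mat 1"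
    "reflection (vector [- 1, 1]) = reflY" "reflection (vector [1, - 1]) = - reflY"
    by (simp_all add: reflection_def reflY_def mat_def vec_eq_iff forall_2)
  then show ?thesis unfolding axis_group_def signs by (simp only: image_insert image_empty)
qed

lemma axial_symmetric_0_flip:
  assumes "axial_symmetric 0 f" "e \<in> signs"
  shows "f (rvec e * \<xi>) = f \<xi>"
proof -
  have "f \<xi> = echar (0 - reflection e *v 0) \<xi> * f (transpose (reflection e) *v \<xi>)"
    using assms unfolding axial_symmetric_def axis_group_eq_reflections by blast
  then show ?thesis by (simp only: transpose_reflection reflection_vector) simp
qed

lemma axial_antisymmetricI:
  assumes "half_integral c"
    and "\<And>e. e \<in> signs \<Longrightarrow> \<exists>\<epsilon>\<in>{1, -1}. \<forall>\<xi>. f \<xi> = \<epsilon> * echar (c - rvec e * c) \<xi> * f (rvec e * \<xi>)"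
  shows "axial_antisymmetric c f"
  unfolding axial_antisymmetric_def
proof (intro conjI ballI assms(1))
  fix E assume "E \<in> axis_group"
  then obtain e where "e \<in> signs" and E: "E = reflection e"
    by (auto simp: axis_group_eq_reflections)
  show "\<exists>\<epsilon>\<in>{1, - 1}. \<forall>\<xi>. f \<xi> = \<epsilon> * echar (c - E *v c) \<xi> * f (transpose E *v \<xi>)"
    unfolding E transpose_reflection reflection_vector by (rule assms(2)[OF \<open>e \<in> signs\<close>])
qed

section \<open>Polyphase components from coset parts\<close>

lemma det_rmat: "det (rmat M) = real_of_int (det (M :: int ^ 2 ^ 2))"
  by (simp add: det_2 map_matrix_def)

lemma rvec_matrix_mult: "rvec (M *v l) = rmat M *v rvec l"
  by (simp add: vec_eq_iff matrix_vector_mult_def map_matrix_def)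

lemma matrix_inv_vector:
  fixes A :: "real ^ 2 ^ 2"
  assumes "det A \<noteq> 0"
  shows "matrix_inv A *v (A *v x) = x"
    "transpose (matrix_inv A) *v (transpose A *v x) = x"
proof -
  have "\<exists>B. A ** B = mat 1 \<and> B ** A = mat 1"
    using assms by (simp add: invertible_det_nz[symmetric] invertible_def)
  then have inv: "A ** matrix_inv A = mat 1 \<and> matrix_inv A ** A = mat 1"
    unfolding matrix_inv_def by (rule someI_ex)
  then have "transpose (matrix_inv A) ** transpose A = mat 1"
    by (simp add: matrix_transpose_mul[symmetric])
  with inv show "matrix_inv A *v (A *v x) = x"
    "transpose (matrix_inv A) *v (transpose A *v x) = x"
    by (simp_all only: matrix_vector_mul_assoc matrix_vector_mul_lid)
qed

text \<open>
  Both forms of \<open>M\<close> enter through their lattice, a product of two one-dimensional lattices. This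
  makes the reflections act on the cosets and treats the diagonal and the antidiagonal case alike.
\<close>
locale diagonal_lattice = positive_moduli N for N :: "int ^ 2" +
  fixes M :: "int ^ 2 ^ 2"
  assumes lattice: "\<And>k. (\<exists>l. k = M *v l) \<longleftrightarrow> (\<forall>i. N $ i dvd k $ i)"
    and card: "card (digit_box N) = absdet M"
begin

abbreviation A :: "real ^ 2 ^ 2" where "A \<equiv> transpose (rmat M)"

lemma absdet_pos: "0 < absdet M"
  using card_digit_box_pos card by simp

lemma det_A: "det A \<noteq> 0"
  using absdet_pos by (simp add: det_transpose det_rmat)

lemma bij_betw_residue_digits:
  assumes "digits M s"
  shows "bij_betw (\<lambda>k. residue N (s k)) {..<absdet M} (digit_box N)"
proof -
  have uniq: "\<exists>!d. d \<in> s ` {..<absdet M} \<and> (\<forall>i. N $ i dvd (k - d) $ i)" for k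
    using assms lattice unfolding digits_def digit_set_def by (simp only: lattice)
  show ?thesis
    unfolding bij_betw_def
  proof (intro conjI equalityI subsetI)
    show "inj_on (\<lambda>k. residue N (s k)) {..<absdet M}"
    proof
      fix j k assume jk: "j \<in> {..<absdet M}" "k \<in> {..<absdet M}" "residue N (s j) = residue N (s k)"
      then have "\<forall>i. N $ i dvd (s j - s k) $ i"
        by (simp add: residue_def vec_eq_iff mod_eq_dvd_iff)
      moreover have "\<forall>i. N $ i dvd (s j - s j) $ i" by simp
      ultimately have "s j = s k" using uniq[of "s j"] jk(1,2) by blast
      then show "j = k" using assms jk(1,2) by (auto simp: digits_def inj_on_def)
    qed
    fix v assume v: "v \<in> digit_box N"
    obtain k where k: "k \<in> {..<absdet M}" "\<And>i. N $ i dvd (v - s k) $ i"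
      using uniq[of v] by blast
    then have "residue N (s k) = v"
      unfolding residue_eq_iff[OF v] by (simp add: dvd_diff_commute)
    with k(1) show "v \<in> (\<lambda>k. residue N (s k)) ` {..<absdet M}" by blast
  qed (auto intro: residue_in_box)
qed

text \<open>
  The polyphase component at the digit \<open>s\<^sub>k\<close> is \<open>\<surd>m\<close> times the part in the coset of \<open>s\<^sub>k\<close>, shifted by
  \<open>- s\<^sub>k\<close> in frequency and expressed in the variable \<open>M\<^sup>* \<xi>\<close>. Working with the coset parts instead
  makes the digits \<open>s\<close> interchangeable with the representatives in the box.
\<close>
lemma polyphase_components_coset_parts:
  assumes s: "digits M s"
    and C: "\<And>v. v \<in> digit_box N \<Longrightarrow> exp_sum (coset_frequencies N v) (C v)"
    and t: "\<And>\<xi>. t \<xi> = (\<Sum>v\<in>digit_box N. C v \<xi>)"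
  shows "polyphase_components M s t (\<lambda>k \<eta>. complex_of_real (sqrt (absdet M)) *
    (echar (- rvec (s k)) (matrix_inv A *v \<eta>) * C (residue N (s k)) (matrix_inv A *v \<eta>)))"
  unfolding polyphase_components_def
proof (intro conjI allI impI)
  fix k assume k: "k < absdet M"
  let ?v = "residue N (s k)"
  have v: "?v \<in> digit_box N" by (rule residue_in_box)
  have "exp_sum (coset_frequencies N 0) (\<lambda>\<xi>. echar (- rvec (s k)) \<xi> * C ?v \<xi>)"
  proof (rule exp_sum_mult[OF exp_sum_echar C[OF v]])
    show "- rvec (s k) \<in> {- rvec (s k)}" by simp
    fix x y assume "x \<in> {- rvec (s k)}" "y \<in> coset_frequencies N ?v"
    then obtain l where l: "x + y = rvec (l - s k)" "\<And>i. N $ i dvd l $ i - ?v $ i"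
      by (auto simp: coset_frequencies_def vec_eq_iff)
    have "N $ i dvd s k $ i - ?v $ i" for i
      using residue_eq_iff[OF v, of "s k"] by simp
    with l(2) have "N $ i dvd (l $ i - ?v $ i) - (s k $ i - ?v $ i)" for i by (rule dvd_diff)
    then have "\<forall>i. N $ i dvd (l - s k) $ i - 0 $ i"
      by simp
    with l(1) show "x + y \<in> coset_frequencies N 0" unfolding coset_frequencies_def by blast
  qed
  then have "exp_sum integral_vectors
      (\<lambda>\<eta>. echar (- rvec (s k)) (matrix_inv A *v \<eta> + 0) * C ?v (matrix_inv A *v \<eta> + 0))"
  proof (rule exp_sum_affine)
    fix x assume "x \<in> coset_frequencies N 0"
    then obtain j where "x = rvec j" "\<forall>i. N $ i dvd j $ i" by (auto simp: coset_frequencies_def)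
    then obtain l where "x = transpose A *v rvec l"
      using lattice[of j] rvec_matrix_mult[of M] by auto
    then have "transpose (matrix_inv A) *v x = rvec l" by (simp only: matrix_inv_vector(2)[OF det_A])
    then show "transpose (matrix_inv A) *v x \<in> integral_vectors" by (rule range_eqI)
  qed
  then show "trig_poly (\<lambda>\<eta>. complex_of_real (sqrt (absdet M)) *
      (echar (- rvec (s k)) (matrix_inv A *v \<eta>) * C ?v (matrix_inv A *v \<eta>)))"
    unfolding trig_poly_iff_exp_sum by (intro exp_sum_cmult) simp
next
  fix \<xi>
  have "(\<Sum>k<absdet M. echar (rvec (s k)) \<xi> * (complex_of_real (sqrt (absdet M)) *
      (echar (- rvec (s k)) \<xi> * C (residue N (s k)) \<xi>))) =
      complex_of_real (sqrt (absdet M)) * (\<Sum>k<absdet M. C (residue N (s k)) \<xi>)"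
  proof -
    have "echar x \<xi> * (r * (cnj (echar x \<xi>) * y)) = (echar x \<xi> * cnj (echar x \<xi>)) * (r * y)"
      for x r y
      by (simp only: mult_ac)
    then have "echar x \<xi> * (r * (echar (- x) \<xi> * y)) = r * y" for x r y
      by (simp only: echar_minus echar_cnj mult_1_left)
    then show ?thesis by (simp only: sum_distrib_left)
  qed
  also have "(\<Sum>k<absdet M. C (residue N (s k)) \<xi>) = t \<xi>"
    unfolding t by (rule sum.reindex_bij_betw[OF bij_betw_residue_digits[OF s]])
  finally show "t \<xi> = 1 / complex_of_real (sqrt (absdet M)) *
      (\<Sum>k<absdet M. echar (rvec (s k)) \<xi> * (complex_of_real (sqrt (absdet M)) *
        (echar (- rvec (s k)) (matrix_inv A *v (A *v \<xi>)) *
          C (residue N (s k)) (matrix_inv A *v (A *v \<xi>)))))"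
    using absdet_pos by (simp only: matrix_inv_vector(1)[OF det_A]) simp
qed

text \<open>
  The unimodular factors that separate polyphase components from coset parts cancel on the
  diagonal, so the mixed extension principle is the orthogonality of coset parts, with
  \<open>1 / m\<close> in place of \<open>1\<close>.
\<close>
lemma wavelet_masksI:
  assumes s: "digits M s"
    and C: "\<And>\<nu> v. v \<in> digit_box N \<Longrightarrow> exp_sum (coset_frequencies N v) (C \<nu> v)"
      "\<And>\<nu> v. v \<in> digit_box N \<Longrightarrow> exp_sum (coset_frequencies N v) (C' \<nu> v)"
    and w: "\<And>\<nu> \<xi>. (w(0 := f)) \<nu> \<xi> = (\<Sum>v\<in>digit_box N. C \<nu> v \<xi>)"
      "\<And>\<nu> \<xi>. (w'(0 := f')) \<nu> \<xi> = (\<Sum>v\<in>digit_box N. C' \<nu> v \<xi>)"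
    and dual: "\<And>v v' \<xi>. v \<in> digit_box N \<Longrightarrow> v' \<in> digit_box N \<Longrightarrow>
      of_nat (absdet M) * (\<Sum>\<nu> = 0..absdet M. C \<nu> v \<xi> * cnj (C' \<nu> v' \<xi>)) = of_bool (v = v')"
  shows "wavelet_masks M s f f' w w'"
proof -
  define part where "part C k \<eta> = complex_of_real (sqrt (absdet M)) *
      (echar (- rvec (s k)) (matrix_inv A *v \<eta>) * C (residue N (s k)) (matrix_inv A *v \<eta>))"
    for C :: "int ^ 2 \<Rightarrow> real ^ 2 \<Rightarrow> complex" and k \<eta>
  have trig: "trig_poly t"
    if "\<And>v. v \<in> digit_box N \<Longrightarrow> exp_sum (coset_frequencies N v) (C v)"
      "\<And>\<xi>. t \<xi> = (\<Sum>v\<in>digit_box N. C v \<xi>)" for C t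
  proof -
    have t: "t = (\<lambda>\<xi>. \<Sum>v\<in>digit_box N. C v \<xi>)" using that(2) by blast
    show ?thesis
      unfolding trig_poly_iff_exp_sum t using that(1)
      by (intro exp_sum_sum) (auto simp: coset_frequencies_def intro: exp_sum_mono)
  qed
  have "part (C \<nu>) k \<eta> * cnj (part (C' \<nu>) l \<eta>) =
      echar (rvec (s l) - rvec (s k)) (matrix_inv A *v \<eta>) *
      (of_nat (absdet M) * (C \<nu> (residue N (s k)) (matrix_inv A *v \<eta>) *
        cnj (C' \<nu> (residue N (s l)) (matrix_inv A *v \<eta>))))" for \<nu> k l \<eta>
  proof -
    have "complex_of_real (sqrt (absdet M)) * complex_of_real (sqrt (absdet M)) = of_nat (absdet M)"
      by (simp only: of_real_mult[symmetric] real_sqrt_mult_self of_real_of_nat_eq abs_of_nat)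
    moreover have "complex_of_real r * (cnj a * x) * cnj (complex_of_real r * (cnj b * y)) =
        (b * cnj a) * ((complex_of_real r * complex_of_real r) * (x * cnj y))" for r a b x y
      by (simp only: complex_cnj_mult complex_cnj_complex_of_real complex_cnj_cnj mult_ac)
    ultimately show ?thesis
      by (simp only: part_def echar_minus echar_diff)
  qed
  then have "(\<Sum>\<nu> = 0..absdet M. part (C \<nu>) k \<eta> * cnj (part (C' \<nu>) l \<eta>)) =
      echar (rvec (s l) - rvec (s k)) (matrix_inv A *v \<eta>) *
      of_bool (residue N (s k) = residue N (s l))" for k l \<eta>
    using dual[OF residue_in_box residue_in_box, of "s k" "matrix_inv A *v \<eta>" "s l"]
    by (simp only: sum_distrib_left[symmetric])
  moreover have "residue N (s k) = residue N (s l) \<longleftrightarrow> k = l"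
    if "k < absdet M" "l < absdet M" for k l
    using bij_betw_residue_digits[OF s] that unfolding bij_betw_def inj_on_def by auto
  ultimately have orth: "(\<Sum>\<nu> = 0..absdet M. part (C \<nu>) k \<eta> * cnj (part (C' \<nu>) l \<eta>)) =
      (if k = l then 1 else 0)" if "k < absdet M" "l < absdet M" for k l \<eta>
    using that by simp
  have "polyphase_components M s ((w(0 := f)) \<nu>) (part (C \<nu>))"
      "polyphase_components M s ((w'(0 := f')) \<nu>) (part (C' \<nu>))" for \<nu>
    unfolding part_def
    by (rule polyphase_components_coset_parts[OF s C(1) w(1)] polyphase_components_coset_parts[OF s C(2) w(2)];
      assumption)+
  moreover have "trig_poly (w \<nu>)" "trig_poly (w' \<nu>)" if "\<nu> \<ge> 1" for \<nu>
    using trig[OF C(1) w(1), of \<nu>] trig[OF C(2) w(2), of \<nu>] that by simp_all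
  ultimately show ?thesis
    unfolding wavelet_masks_def using orth by (intro conjI exI[of _ "\<lambda>\<nu>. part (C \<nu>)"] exI[of _ "\<lambda>\<nu>. part (C' \<nu>)"]) auto
qed

end

section \<open>The sum rule at the dual lattice points\<close>

text \<open>
  The map \<open>M\<^sup>*\<close> sends the nonzero dual points to integral vectors outside the lattice of \<open>M\<^sup>*\<close>, that is,
  to translates of nonzero digits in \<open>D\<close> by lattice vectors; periodicity removes the translate.
\<close>
lemma (in diagonal_lattice) sum_rule_dual_points:
  assumes f: "exp_sum integral_vectors f" and D: "digit_set (transpose M) D"
    and sr: "sum_rule M D n f" and p: "p \<in> digit_box N - {0}"
  shows "vanishes_to_order n (\<lambda>\<xi>. f (\<xi> + dual_point N p)) 0"
proof -
  define x where "x = dual_point N p"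
  have "\<forall>i. \<exists>q. (A *v x) $ i = real_of_int q"
  proof
    fix i
    have "N $ j dvd M $ j $ i" for j
    proof -
      have "N $ j dvd (M *v axis i 1) $ j" using lattice[of "M *v axis i 1"] by blast
      moreover have "(M *v axis i 1) $ j = M $ j $ i"
        by (simp add: matrix_vector_mult_def axis_def if_distrib cong: if_cong)
      ultimately show ?thesis by simp
    qed
    have "real_of_int (M $ j $ i) * (p $ j / N $ j) \<in> \<int>" for j
    proof -
      obtain z where "M $ j $ i = N $ j * z" using \<open>N $ j dvd M $ j $ i\<close> by (rule dvdE)
      then show ?thesis using N_pos[of j] by simp
    qed
    then have "(A *v x) $ i \<in> \<int>"
      by (auto simp: x_def dual_point_def matrix_vector_mult_def transpose_def map_matrix_def
        intro!: Ints_sum simp del: transpose_matrix_vector)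
    then show "\<exists>q. (A *v x) $ i = real_of_int q" by (auto elim: Ints_cases)
  qed
  then obtain q where q: "(A *v x) $ i = real_of_int (q i)" for i by metis
  define r where "r = (\<chi> i. q i)"
  have r: "A *v x = rvec r" unfolding vec_eq_iff r_def q by simp
  obtain d l where d: "d \<in> D" "r - d = transpose M *v l"
    using D unfolding digit_set_def by blast
  have rd: "rvec r = rvec d + A *v rvec l"
  proof -
    have "rvec r = rvec d + rvec (r - d)" by (simp add: vec_eq_iff)
    also have "rvec (r - d) = rmat (transpose M) *v rvec l" unfolding d(2) by (rule rvec_matrix_mult)
    also have "rmat (transpose M) = A" by (simp add: vec_eq_iff transpose_def map_matrix_def)
    finally show ?thesis .
  qed
  have "d \<noteq> 0"
  proof
    assume "d = 0"
    then have "A *v x = A *v rvec l" using r rd by (simp add: vec_eq_iff)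
    then have "x = rvec l" by (metis matrix_inv_vector(1)[OF det_A])
    have "p $ i = 0" for i
    proof -
      have "real_of_int (p $ i) / real_of_int (N $ i) = real_of_int (l $ i)"
        using \<open>x = rvec l\<close> by (simp add: x_def dual_point_def vec_eq_iff)
      then have "real_of_int (p $ i) = real_of_int (N $ i * l $ i)"
        using N_pos[of i] by (simp add: field_simps)
      then have "N $ i dvd p $ i" by (simp only: of_int_eq_iff dvd_triv_left)
      moreover have "p $ i mod N $ i = p $ i" using p by (simp add: digit_box_def)
      ultimately show ?thesis by (simp add: dvd_eq_mod_eq_0)
    qed
    with p show False by (simp add: vec_eq_iff)
  qed
  then have "vanishes_to_order n (\<lambda>\<xi>. f (matrix_inv A *v \<xi>)) (rvec d)"
    using sr d(1) unfolding sum_rule_def by blast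
  moreover have "exp_sum UNIV (\<lambda>\<xi>. f (matrix_inv A *v \<xi>))"
    using exp_sum_affine[OF f, of "matrix_inv A" UNIV 0] by simp
  ultimately have "vanishes_to_order n (\<lambda>\<xi>. f (matrix_inv A *v (A *v \<xi> + rvec d))) 0"
    using vanishes_to_order_affine[where A = A and b = "rvec d" and x = 0 and n = n]
    by (simp del: transpose_matrix_vector)
  moreover have "f (matrix_inv A *v (A *v \<xi> + rvec d)) = f (\<xi> + x)" for \<xi>
  proof -
    have "matrix_inv A *v rvec d = x + rvec (- l)"
    proof -
      have "rvec d = A *v (x + rvec (- l))"
        unfolding matrix_vector_right_distrib rvec_minus r rd
        by (simp add: matrix_vector_mult_def vec_eq_iff sum_negf)
      then show ?thesis by (simp only: matrix_inv_vector(1)[OF det_A])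
    qed
    then show ?thesis
      by (simp only: matrix_vector_right_distrib matrix_inv_vector(1)[OF det_A]
        add.assoc[symmetric] exp_sum_int_periodic[OF f])
  qed
  ultimately show ?thesis by (simp only: x_def)
qed

section \<open>The symmetric wavelet masks\<close>

lemma coset_frequencies_add:
  "x \<in> coset_frequencies N u \<Longrightarrow> y \<in> coset_frequencies N v \<Longrightarrow> x + y \<in> coset_frequencies N (u + v)"
  unfolding coset_frequencies_def
proof clarify
  fix k l assume "\<forall>i. N $ i dvd k $ i - u $ i" "\<forall>i. N $ i dvd l $ i - v $ i"
  then have "\<forall>i. N $ i dvd (k $ i - u $ i) + (l $ i - v $ i)" by (simp add: dvd_add)
  then have "\<forall>i. N $ i dvd (k + l) $ i - (u + v) $ i" by (simp add: algebra_simps)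
  then show "\<exists>j. rvec k + rvec l = rvec j \<and> (\<forall>i. N $ i dvd j $ i - (u + v) $ i)"
    using rvec_add by metis
qed

lemma coset_frequencies_minus:
  "x \<in> coset_frequencies N u \<Longrightarrow> - x \<in> coset_frequencies N (- u)"
  unfolding coset_frequencies_def
proof clarify
  fix k assume "\<forall>i. N $ i dvd k $ i - u $ i"
  then have "\<forall>i. N $ i dvd (- k) $ i - (- u) $ i" by (simp add: dvd_diff_commute)
  then show "\<exists>j. - rvec k = rvec j \<and> (\<forall>i. N $ i dvd j $ i - (- u) $ i)"
    using rvec_minus by metis
qed

lemma rvec_in_coset_frequencies: "rvec v \<in> coset_frequencies N v"
  unfolding coset_frequencies_def by auto

context diagonal_lattice
begin

text \<open>
  In terms of coset parts, the given pair contributes the products \<open>P\<^sub>v cnj P'\<^sub>u\<close>, and the wavelet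
  masks have to supply the difference to the identity. Without symmetry, the masks
  \<open>e\<^sub>v / \<surd>m\<close> and \<open>e\<^sub>v (1 - m cnj P\<^sub>v f') / \<surd>m\<close> do so, where \<open>e\<^sub>v\<close> is the exponential with frequency \<open>v\<close>.
  A real orthogonal matrix applied to both families preserves the sums of products, so
  the folding matrix may be used to make the masks symmetric.
\<close>
lemma exists_symmetric_wavelet_masks:
  assumes s: "digits M s" and D: "digit_set (transpose M) D"
    and f: "trig_poly f" and f': "trig_poly f'"
    and sym: "axial_symmetric 0 f" "axial_symmetric 0 f'"
    and sr: "sum_rule M D n f"
    and dual: "vanishes_to_order n (\<lambda>\<xi>. 1 - f \<xi> * cnj (f' \<xi>)) 0"
  shows "\<exists>w w'. wavelet_masks M s f f' w w' \<and>
    (\<forall>\<nu>\<in>{1..absdet M}. (\<exists>c. axial_antisymmetric c (w \<nu>) \<and> axial_antisymmetric c (w' \<nu>)) \<and>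
      vanishing_moments n (w' \<nu>))"
proof -
  note f = f[unfolded trig_poly_iff_exp_sum] and f' = f'[unfolded trig_poly_iff_exp_sum]
  let ?m = "absdet M" and ?B = "digit_box N"
  define r where "r = complex_of_real (sqrt ?m)"
  have r: "r * r = of_nat ?m" "cnj r = r" "r \<noteq> 0"
    using absdet_pos
    by (simp_all only: r_def of_real_mult[symmetric] real_sqrt_mult_self of_real_of_nat_eq abs_of_nat
      complex_cnj_complex_of_real of_real_eq_0_iff real_sqrt_eq_zero_cancel_iff of_nat_eq_0_iff)
  obtain row where row: "bij_betw row {1..?m} ?B"
    using finite_same_card_bij[of "{1..?m}" ?B] card by auto
  define P where "P = coset_part N f"
  define P' where "P' = coset_part N f'"
  define U where "U a v = complex_of_real (fold_matrix N a v)" for a v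
  define e where "e v = echar (rvec v)" for v :: "int ^ 2"
  define c where "c a \<xi> = (\<Sum>u\<in>?B. U a u * (e u \<xi> * cnj (P u \<xi>)))" for a \<xi>
  \<comment> \<open>The coset parts of the masks \<open>w\<close> and \<open>w'\<close> below and, at index \<open>0\<close>, of the given pair.\<close>
  define C where "C \<nu> v = (if \<nu> = 0 then P v else (\<lambda>\<xi>. U (row \<nu>) v / r * e v \<xi>))" for \<nu> :: nat and v
  define C' where "C' \<nu> v = (if \<nu> = 0 then P' v else
      (\<lambda>\<xi>. U (row \<nu>) v / r * e v \<xi> - r * (c (row \<nu>) \<xi> * P' v \<xi>)))" for \<nu> :: nat and v
  define w where "w \<nu> \<xi> = (\<Sum>v\<in>?B. U (row \<nu>) v * e v \<xi> * (1 / r))" for \<nu> \<xi>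
  define w' where "w' \<nu> \<xi> = (\<Sum>v\<in>?B. U (row \<nu>) v * e v \<xi> * (1 / r - r * cnj (P v \<xi>) * f' \<xi>))"
    for \<nu> \<xi>
  have P: "exp_sum (coset_frequencies N v) (P v)" "exp_sum (coset_frequencies N v) (P' v)" for v
    unfolding P_def P'_def by (rule exp_sum_coset_part f f')+
  have e: "exp_sum (coset_frequencies N v) (e v)" for v
    unfolding e_def by (intro exp_sum_echar rvec_in_coset_frequencies)
  have "exp_sum (coset_frequencies N 0) (\<lambda>\<xi>. e u \<xi> * cnj (P u \<xi>))" for u
    using coset_frequencies_add[of _ N u _ "- u"]
    by (intro exp_sum_mult[OF e exp_sum_cnj[OF P(1) coset_frequencies_minus]]) auto
  then have c: "exp_sum (coset_frequencies N 0) (c a)" for a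
    unfolding c_def by (intro exp_sum_sum exp_sum_cmult)
  have cP: "exp_sum (coset_frequencies N v) (\<lambda>\<xi>. c a \<xi> * P' v \<xi>)" for a v
    using coset_frequencies_add[of _ N 0 _ v] by (intro exp_sum_mult[OF c P(2)]) auto
  have C: "exp_sum (coset_frequencies N v) (C \<nu> v)" "exp_sum (coset_frequencies N v) (C' \<nu> v)" for \<nu> v
  proof -
    have "exp_sum (coset_frequencies N v) (\<lambda>\<xi>. U (row \<nu>) v / r * e v \<xi>)"
      by (intro exp_sum_cmult e)
    moreover have "exp_sum (coset_frequencies N v)
        (\<lambda>\<xi>. U (row \<nu>) v / r * e v \<xi> - r * (c (row \<nu>) \<xi> * P' v \<xi>))"
      by (intro exp_sum_diff exp_sum_cmult e cP)
    ultimately show "exp_sum (coset_frequencies N v) (C \<nu> v)" "exp_sum (coset_frequencies N v) (C' \<nu> v)"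
      unfolding C_def C'_def using P by (simp_all only: simp_thms split: if_split)
  qed
  have U: "(\<Sum>a\<in>?B. U a v * U a v') = of_bool (v = v')" if "v \<in> ?B" "v' \<in> ?B" for v v'
    unfolding U_def using fold_matrix_orthogonal[OF that]
    by (simp flip: of_real_mult of_real_sum)
  \<comment> \<open>Orthogonality of the rows undoes the folding in \<open>c\<close> and leaves one coset part of \<open>f\<close>.\<close>
  have Uc: "(\<Sum>a\<in>?B. U a v * cnj (c a \<xi>)) = cnj (e v \<xi>) * P v \<xi>" if v: "v \<in> ?B" for v \<xi>
  proof -
    have "(\<Sum>a\<in>?B. U a v * cnj (c a \<xi>)) =
        (\<Sum>a\<in>?B. \<Sum>u\<in>?B. U a v * U a u * (cnj (e u \<xi>) * P u \<xi>))"
      by (simp add: c_def sum_distrib_left U_def mult.assoc)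
    also have "\<dots> = (\<Sum>u\<in>?B. (\<Sum>a\<in>?B. U a v * U a u) * (cnj (e u \<xi>) * P u \<xi>))"
      by (subst sum.swap) (simp only: sum_distrib_right)
    also have "\<dots> = (\<Sum>u\<in>?B. if u = v then cnj (e u \<xi>) * P u \<xi> else 0)"
      by (intro sum.cong refl) (simp add: U[OF v])
    finally show ?thesis using v by simp
  qed
  have masks: "wavelet_masks M s f f' w w'"
  proof (rule wavelet_masksI[OF s C])
    show "(w(0 := f)) \<nu> \<xi> = (\<Sum>v\<in>?B. C \<nu> v \<xi>)" for \<nu> \<xi>
      by (simp add: C_def w_def P_def sum_coset_part[OF f])
    show "(w'(0 := f')) \<nu> \<xi> = (\<Sum>v\<in>?B. C' \<nu> v \<xi>)" for \<nu> \<xi>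
    proof (cases "\<nu> = 0")
      case True
      then show ?thesis by (simp add: C'_def P'_def sum_coset_part[OF f'])
    next
      case False
      have "(\<Sum>v\<in>?B. r * (c (row \<nu>) \<xi> * P' v \<xi>)) = r * (c (row \<nu>) \<xi> * f' \<xi>)"
        by (simp only: sum_distrib_left[symmetric]) (simp only: P'_def sum_coset_part[OF f'])
      also have "\<dots> = (\<Sum>v\<in>?B. U (row \<nu>) v * e v \<xi> * (r * cnj (P v \<xi>) * f' \<xi>))"
        by (simp add: c_def sum_distrib_left sum_distrib_right mult_ac)
      finally show ?thesis
        using False by (simp add: C'_def w'_def sum_subtractf right_diff_distrib)
    qed
    fix v v' \<xi> assume v: "v \<in> ?B" "v' \<in> ?B"
    have "C \<nu> v \<xi> * cnj (C' \<nu> v' \<xi>) =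
        U (row \<nu>) v * U (row \<nu>) v' * (e v \<xi> * cnj (e v' \<xi>) / (r * r)) -
        U (row \<nu>) v * cnj (c (row \<nu>) \<xi>) * (e v \<xi> * cnj (P' v' \<xi>))" if "\<nu> \<in> {1..?m}" for \<nu>
    proof -
      have "cnj (U a v) = U a v" for a v by (simp add: U_def)
      moreover have "x / r * y * (x' / r * y' - r * (z * q)) =
          x * x' * (y * y' / (r * r)) - x * z * (y * q)" for x y x' y' z q
        using r(3) by (simp add: field_simps)
      ultimately show ?thesis
        using that by (simp add: C_def C'_def r(2))
    qed
    then have "(\<Sum>\<nu>=1..?m. C \<nu> v \<xi> * cnj (C' \<nu> v' \<xi>)) = (\<Sum>\<nu>=1..?m.
        U (row \<nu>) v * U (row \<nu>) v' * (e v \<xi> * cnj (e v' \<xi>) / (r * r)) -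
        U (row \<nu>) v * cnj (c (row \<nu>) \<xi>) * (e v \<xi> * cnj (P' v' \<xi>)))"
      by (rule sum.cong[OF refl])
    also have "\<dots> = (\<Sum>a\<in>?B. U a v * U a v' * (e v \<xi> * cnj (e v' \<xi>) / (r * r)) -
        U a v * cnj (c a \<xi>) * (e v \<xi> * cnj (P' v' \<xi>)))"
      by (rule sum.reindex_bij_betw[OF row])
    also have "\<dots> = of_bool (v = v') * (e v \<xi> * cnj (e v' \<xi>) / (r * r)) -
        cnj (e v \<xi>) * P v \<xi> * (e v \<xi> * cnj (P' v' \<xi>))"
      by (simp only: sum_subtractf sum_distrib_right[symmetric] U[OF v] Uc[OF v(1)])
    also have "\<dots> = of_bool (v = v') / of_nat ?m - P v \<xi> * cnj (P' v' \<xi>)"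
    proof -
      have 1: "e v \<xi> * cnj (e v \<xi>) = 1" by (simp only: e_def echar_cnj)
      have "cnj (e v \<xi>) * P v \<xi> * (e v \<xi> * cnj (P' v' \<xi>)) =
          (e v \<xi> * cnj (e v \<xi>)) * (P v \<xi> * cnj (P' v' \<xi>))"
        by (simp only: mult_ac)
      with 1 show ?thesis by (auto simp: r(1))
    qed
    finally show "of_nat ?m * (\<Sum>\<nu> = 0..?m. C \<nu> v \<xi> * cnj (C' \<nu> v' \<xi>)) = of_bool (v = v')"
      using absdet_pos by (simp add: sum.atLeast_Suc_atMost C_def C'_def field_simps)
  qed
  have anti: "axial_antisymmetric (fold_centre N (row \<nu>)) (\<lambda>\<xi>. \<Sum>v\<in>?B. U (row \<nu>) v * e v \<xi> * F v \<xi>)"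
    if "\<nu> \<in> {1..?m}" "\<And>g v \<xi>. g \<in> signs \<Longrightarrow> v \<in> ?B \<Longrightarrow> F (residue N (g * v)) \<xi> = F v (rvec g * \<xi>)" for F \<nu>
    unfolding U_def e_def
  proof (rule axial_antisymmetricI)
    show "half_integral (fold_centre N (row \<nu>))"
      unfolding half_integral_def
      by (rule exI[of _ "\<chi> i. if row \<nu> $ i = 0 then 0 else N $ i"])
         (simp add: fold_centre_def vec_eq_iff)
  qed (intro fold_combination_symmetric bij_betwE[OF row, rule_format] that)
  have flip: "f' (rvec g * \<xi>) = f' \<xi>" "P (residue N (g * v)) \<xi> = P v (rvec g * \<xi>)"
    if "g \<in> signs" for g v \<xi>
    unfolding P_def using that sym
    by (auto intro: axial_symmetric_0_flip coset_part_flip[OF f])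
  have "axial_antisymmetric (fold_centre N (row \<nu>)) (w \<nu>)" if "\<nu> \<in> {1..?m}" for \<nu>
    unfolding w_def[abs_def] by (rule anti[OF that]) simp
  moreover have "axial_antisymmetric (fold_centre N (row \<nu>)) (w' \<nu>)" if "\<nu> \<in> {1..?m}" for \<nu>
    unfolding w'_def[abs_def] by (rule anti[OF that]) (simp add: flip)
  moreover have "vanishing_moments n (w' \<nu>)" for \<nu>
  proof -
    have fU: "exp_sum UNIV f" "exp_sum UNIV f'" "exp_sum UNIV (P v)" "exp_sum UNIV (e v)" for v
      using f f' P e by (auto intro: exp_sum_mono)
    have fc: "exp_sum UNIV (\<lambda>\<xi>. 1 - f \<xi> * cnj (f' \<xi>))"
      by (intro exp_sum_diff exp_sum_const exp_sum_mult[OF fU(1) exp_sum_cnj[OF fU(2), of UNIV]]) auto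
    have fP: "exp_sum UNIV (\<lambda>\<xi>. f \<xi> - of_nat ?m * P v \<xi>)" for v
      by (intro exp_sum_diff exp_sum_cmult fU)
    \<comment> \<open>This is \<open>1 - m cnj P\<^sub>v f'\<close>, written as a sum of two terms that vanish to order \<open>n\<close> at \<open>0\<close>.\<close>
    define G where "G v \<xi> = cnj (1 - f \<xi> * cnj (f' \<xi>)) + cnj (f \<xi> - of_nat ?m * P v \<xi>) * f' \<xi>" for v \<xi>
    have G: "exp_sum UNIV (G v)" for v
      unfolding G_def[abs_def]
      by (intro exp_sum_add exp_sum_mult[of UNIV _ UNIV] exp_sum_cnj[of UNIV] fU fc fP) auto
    have "vanishes_to_order n (\<lambda>\<xi>. f \<xi> - of_nat ?m * P v \<xi>) 0" for v
      using coset_part_approx[OF f sum_rule_dual_points[OF f D sr]] by (simp add: P_def card)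
    then have "vanishes_to_order n (G v) 0" for v
      unfolding G_def[abs_def] using dual
      by (intro vanishes_to_order_add[of UNIV] vanishes_to_order_mult vanishes_to_order_cnj
        exp_sum_mult[of UNIV _ UNIV] exp_sum_cnj[of UNIV] fU fc fP) auto
    then have "vanishes_to_order n (\<lambda>\<xi>. \<Sum>v\<in>?B. G v \<xi> * (U (row \<nu>) v / r * e v \<xi>)) 0"
      by (intro vanishes_to_order_sum[of _ UNIV] vanishes_to_order_mult
        exp_sum_mult[of UNIV _ UNIV] exp_sum_cmult G fU) auto
    moreover have "w' \<nu> = (\<lambda>\<xi>. \<Sum>v\<in>?B. G v \<xi> * (U (row \<nu>) v / r * e v \<xi>))"
      unfolding w'_def
    proof (intro ext sum.cong refl)
      fix v \<xi>
      have "x * y * (1 / r - r * p * q) = (1 - g * q + (g - r * r * p) * q) * (x / r * y)" for x y p q g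
        using r(3) by (simp add: field_simps)
      then show "U (row \<nu>) v * e v \<xi> * (1 / r - r * cnj (P v \<xi>) * f' \<xi>) =
          G v \<xi> * (U (row \<nu>) v / r * e v \<xi>)"
        unfolding G_def r(1)[symmetric] by (simp add: r(2))
    qed
    ultimately show ?thesis unfolding vanishing_moments_def by (simp only:)
  qed
  ultimately show ?thesis using masks by blast
qed

end

text \<open>
  Nonsingularity comes from the digits: a singular \<open>M\<close> would have \<open>|det M| = 0\<close> digits, which cannot
  represent any coset.
\<close>
lemma diagonal_latticeI:
  assumes M: "M = vector [vector [\<gamma>1, 0], vector [0, \<gamma>2]] \<or>
      M = vector [vector [0, \<gamma>1], vector [\<gamma>2, 0]]"
    and s: "digits M s"
  shows "diagonal_lattice (vector [\<bar>\<gamma>1\<bar>, \<bar>\<gamma>2\<bar>]) M"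
proof -
  have "\<exists>d. d \<in> s ` {..<absdet M}"
    using s unfolding digits_def digit_set_def by blast
  then have "det M \<noteq> 0" by auto
  moreover have det: "\<bar>det M\<bar> = \<bar>\<gamma>1\<bar> * \<bar>\<gamma>2\<bar>"
    using M by (auto simp: det_2 abs_mult)
  ultimately have nz: "\<gamma>1 \<noteq> 0" "\<gamma>2 \<noteq> 0" by auto
  show ?thesis
  proof
    fix i :: 2
    show "0 < (vector [\<bar>\<gamma>1\<bar>, \<bar>\<gamma>2\<bar>] :: int ^ 2) $ i"
      using nz exhaust_2[of i] by auto
  next
    fix k
    have "(\<exists>l. k = M *v l) \<longleftrightarrow> (\<exists>x y. k $ 1 = \<gamma>1 * x \<and> k $ 2 = \<gamma>2 * y)"
    proof
      assume "\<exists>l. k = M *v l"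
      then show "\<exists>x y. k $ 1 = \<gamma>1 * x \<and> k $ 2 = \<gamma>2 * y"
        using M by (auto simp: matrix_vector_mult_def sum_2)
    next
      assume "\<exists>x y. k $ 1 = \<gamma>1 * x \<and> k $ 2 = \<gamma>2 * y"
      then obtain x y where "k $ 1 = \<gamma>1 * x" "k $ 2 = \<gamma>2 * y" by blast
      then have "k = M *v vector [x, y] \<or> k = M *v vector [y, x]"
        using M by (auto simp: matrix_vector_mult_def sum_2 vec_eq_iff forall_2)
      then show "\<exists>l. k = M *v l" by blast
    qed
    also have "\<dots> \<longleftrightarrow> \<gamma>1 dvd k $ 1 \<and> \<gamma>2 dvd k $ 2" by (auto simp: dvd_def)
    finally show "(\<exists>l. k = M *v l) \<longleftrightarrow> (\<forall>i. (vector [\<bar>\<gamma>1\<bar>, \<bar>\<gamma>2\<bar>] :: int ^ 2) $ i dvd k $ i)"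
      by (simp add: forall_2)
  next
    show "card (digit_box (vector [\<bar>\<gamma>1\<bar>, \<bar>\<gamma>2\<bar>])) = absdet M"
      by (simp add: card_box UNIV_2 det nat_mult_distrib)
  qed
qed

theorem theorem26:
  fixes M :: "int ^ 2 ^ 2" and \<gamma>1 \<gamma>2 :: int and m n :: nat
    and s :: "nat \<Rightarrow> int ^ 2" and D :: "(int ^ 2) set"
    and m0 m0' :: "real ^ 2 \<Rightarrow> complex"
  assumes "matrix_dilation M"
    and "M = vector [vector [\<gamma>1, 0], vector [0, \<gamma>2]] \<or>
         M = vector [vector [0, \<gamma>1], vector [\<gamma>2, 0]]"
    and "m = nat \<bar>det M\<bar>"
    and "n \<ge> 1"
    and "digits M s"
    and "digit_set (transpose M) D" and "0 \<in> D"
    and "is_mask m0" and "is_mask m0'"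
    and "axial_symmetric 0 m0" and "axial_symmetric 0 m0'"
    and "sum_rule M D n m0"
    and "\<forall>\<beta> \<in> Delta n. mixed_partial \<beta> (\<lambda>\<xi>. 1 - m0 \<xi> * cnj (m0' \<xi>)) 0 = 0"
  shows "\<exists>w w'. wavelet_masks M s m0 m0' w w' \<and>
           (\<forall>\<nu> \<in> {1..m}.
              (\<exists>c. axial_symmetric c (w \<nu>) \<or> axial_antisymmetric c (w \<nu>)) \<and>
              (\<exists>c. axial_symmetric c (w' \<nu>) \<or> axial_antisymmetric c (w' \<nu>)) \<and>
              vanishing_moments n (w' \<nu>))"
proof -
  interpret diagonal_lattice "vector [\<bar>\<gamma>1\<bar>, \<bar>\<gamma>2\<bar>]" M
    using assms(2,5) by (rule diagonal_latticeI)
  show ?thesis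
    using exists_symmetric_wavelet_masks[OF assms(5,6) _ _ assms(10-13)] assms(8,9)
    unfolding is_mask_def assms(3) by blast
qed

end
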